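(* For all $x\in\mathbb{C}$, $$\xi_\tau(x)=\sum_{s=0}^\infty\chi(s)(x-6)^{2s},$$ where, for each integer $s\ge0$, $$\chi(s)=2\int_0^1 L(i\omega)\,\omega^5\left[\frac{(\ln\omega)^{2s}}{(2s)!}\right]d\omega,$$ and the coefficients $\chi(s)$ are positive real numbers.
   Context: For $\Im(x)>0$, $L(x)=q\prod_{n=1}^\infty(1-q^n)^{24}=\sum_{m=1}^\infty\tau(m)q^m$ with $q=e^{2\pi i x}$; this defines the Ramanujan function $\tau(m)$. The Ramanujan zeta function is $H_\tau(x)=\sum_{\ell=1}^\infty \tau(\ell)\ell^{-x}$ for $\Re(x)>13/2$, and $H_\tau$ also denotes its analytic continuation to $\mathbb{C}$. The Ramanujan-Rankin function $\xi_\tau(x)=(2\pi)^{-x}\Gamma(x)H_\tau(x)$ extends to an entire function of $x\in\mathbb{C}$ (denoted by the same symbol). *)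

theory Defs
  imports "HOL-Complex_Analysis.Complex_Analysis"
begin

definition nome :: "complex \<Rightarrow> complex" where
  "nome x = exp (2 * of_real pi * \<i> * x)"

text \<open>Only meaningful for \<open>Im x > 0\<close>, where the product converges.\<close>

definition ramanujan_L :: "complex \<Rightarrow> complex" where
  "ramanujan_L x = nome x * (\<Prod>n. (1 - nome x ^ Suc n) ^ 24)"

text \<open>
  The coefficients of the \<open>q\<close>-expansion of \<open>ramanujan_L\<close>. The expansion starts at \<open>q\<^sup>1\<close>; the
  irrelevant value at index 0 is set to 0, so that the description determines a unique sequence.
\<close>

definition ramanujan_tau :: "nat \<Rightarrow> complex" where
  "ramanujan_tau = (THE t. t 0 = 0 \<and>
     (\<forall>x. Im x > 0 \<longrightarrow> (\<lambda>m. t (Suc m) * nome x ^ Suc m) sums ramanujan_L x))"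

definition ramanujan_zeta_series :: "complex \<Rightarrow> complex" where
  "ramanujan_zeta_series x = (\<Sum>l. ramanujan_tau (Suc l) * of_nat (Suc l) powr (- x))"

definition ramanujan_zeta :: "complex \<Rightarrow> complex" where
  "ramanujan_zeta = (THE H. H holomorphic_on UNIV \<and>
     (\<forall>x. Re x > 13 / 2 \<longrightarrow> H x = ramanujan_zeta_series x))"

text \<open>
  The poles of \<open>Gamma\<close> (the nonpositive integers, where the library sets it to 0) are excluded
  from the defining equation; the values there are determined by the entire extension.
\<close>

definition xi_tau :: "complex \<Rightarrow> complex" where
  "xi_tau = (THE f. f holomorphic_on UNIV \<and>
     (\<forall>x. x \<notin> \<int>\<^sub>\<le>\<^sub>0 \<longrightarrow> f x = (2 * of_real pi) powr (- x) * Gamma x * ramanujan_zeta x))"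

definition chi :: "nat \<Rightarrow> complex" where
  "chi s = 2 * (LBINT \<omega>=0..1. ramanujan_L (\<i> * of_real \<omega>) * of_real (\<omega> ^ 5)
                  * of_real (ln \<omega> ^ (2 * s) / fact (2 * s)))"

end

theory Submission imports Defs begin

text \<open>
  Splitting the Mellin transform of \<open>L(i\<omega>)\<close> at \<open>\<omega> = 1\<close> and using \<open>L(i/\<omega>) = \<omega>\<^sup>1\<^sup>2 L(i\<omega>)\<close> gives
  \<open>\<xi>\<^sub>\<tau>(x) = 2 \<integral>\<^sub>0\<^sup>1 L(i\<omega>) \<omega>\<^sup>5 cosh ((x - 6) ln \<omega>) d\<omega>\<close>; expanding the hyperbolic cosine yields the series.
  Its sum is entire, and this provides the analytic continuations.

  On the imaginary axis \<open>ln \<Prod>(1 - q\<^sup>n)\<close> is a Lambert series, whose behaviour under \<open>t \<mapsto> 1 / t\<close> follows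
  from the partial fraction expansion of the hyperbolic cotangent. The identity theorem extends the
  inversion formula to the upper half-plane, where it bounds \<open>|L(z)| (Im z)\<^sup>6\<close>. Cauchy's inequality for
  \<open>\<Sum>\<tau>(n) q\<^sup>n / (1 - q)\<close> then shows that the partial sums of \<open>\<tau>\<close> are \<open>O(N\<^bsup>13/2\<^esup>)\<close>, so the Dirichlet series
  converges for \<open>Re x > 13/2\<close>.
\<close>

section \<open>Inversion of the Lambert series\<close>

text \<open>The definite description of \<open>ramanujan_zeta\<close> denotes the intended function
  only if the series itself agrees with an entire function on all of Re x > 13/2. The bound on
  |L(z)| (Im z)^6 alone gives tau(n) = O(n^6), hence absolute convergence only for Re x > 7; near
  the boundary line convergence has to come from cancellation in the partial sums. With q = exp(2 pi
  i w), dividing by 1 - q costs a factor 1/|w|. Estimating |w| from below by Im w would give partial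
  sums O(N^7); the decay of L at the cusp 0 saves half a power. The Mellin transform is integrated
  termwise only for Re x > 15/2, where a crude coefficient bound gives absolute convergence. The
  strip down to 13/2 follows by analytic continuation, since summation by parts makes the series
  holomorphic there. The inversion formula is proved first on the imaginary axis because L is
  positive there and logarithms are real.\<close>

lemma coth_partial_fractions:
  fixes a :: real
  assumes a: "a > 0"
  shows "(\<lambda>n. a / (a\<^sup>2 + (real (Suc n))\<^sup>2)) sums (pi / (exp (2*pi*a) - 1) + pi / 2 - 1 / (2*a))"
proof -
  define z where "z = \<i> * complex_of_real a"
  have zim: "Im z = a" "Re z = 0" by (auto simp: z_def)
  have nz: "z \<noteq> 0" using a by (auto simp: z_def)
  have nint: "w \<notin> \<int>" if "Im w \<noteq> 0" for w :: complex
    using that by (auto elim!: Ints_cases)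
  have nint': "w \<notin> \<int>\<^sub>\<le>\<^sub>0" if "Im w \<noteq> 0" for w :: complex
    using nint[OF that] nonpos_Ints_Int by blast
  have sinnz: "sin (of_real pi * w) \<noteq> 0" if "Im w \<noteq> 0" for w :: complex
    using nint[OF that] by (auto simp: sin_eq_0 mult.commute)
  \<comment> \<open>Differentiating Gamma(w) Gamma(1 - w) = pi / sin(pi w) on both sides gives the
    reflection formula for Digamma, hence pi cot(pi z); at z = i a the cotangent becomes
    hyperbolic.\<close>
  have 1: "((\<lambda>w. Gamma w * Gamma (1 - w)) has_field_derivative
      (Gamma z * Digamma z * Gamma (1 - z) - Gamma z * (Gamma (1 - z) * Digamma (1 - z)))) (at z)"
    using nint'[of z] nint'[of "1 - z"] zim a
    by (auto intro!: derivative_eq_intros)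
  have "((\<lambda>w. of_real pi / sin (of_real pi * w)) has_field_derivative
      (- (of_real pi * (cos (of_real pi * z) * of_real pi)) / (sin (of_real pi * z))\<^sup>2)) (at z)"
    using sinnz[of z] zim a by (auto intro!: derivative_eq_intros simp: power2_eq_square)
  hence 2: "((\<lambda>w. Gamma w * Gamma (1 - w)) has_field_derivative
      (- (of_real pi * (cos (of_real pi * z) * of_real pi)) / (sin (of_real pi * z))\<^sup>2)) (at z)"
    by (simp add: Gamma_reflection_complex)
  have *: "Gamma z * Gamma (1 - z) * (Digamma z - Digamma (1 - z)) =
      - (of_real pi * (cos (of_real pi * z) * of_real pi)) / (sin (of_real pi * z))\<^sup>2"
    using DERIV_unique[OF 1 2] by (simp add: algebra_simps)
  have dig: "Digamma z - Digamma (1 - z) = - of_real pi * cos (of_real pi * z) / sin (of_real pi * z)"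
  proof -
    define p where "p = complex_of_real pi"
    define sn where "sn = sin (p * z)"
    have nz: "p \<noteq> 0" "sn \<noteq> 0" using sinnz[of z] zim a by (auto simp: p_def sn_def)
    have "p / sn * (Digamma z - Digamma (1 - z)) = - (p * (cos (p * z) * p)) / sn\<^sup>2"
      using * unfolding Gamma_reflection_complex p_def sn_def .
    also have "\<dots> = p / sn * (- p * cos (p * z) / sn)" by (simp add: power2_eq_square)
    finally show ?thesis using nz unfolding p_def sn_def by (simp only: mult_cancel_left divide_eq_0_iff) simp
  qed
  \<comment> \<open>Passing from z to z + 1 makes the two Digamma series symmetric: their
    denominators are n + 1 + z and n + 1 - z, with product (n + 1)^2 + a^2.\<close>
  have dp: "Digamma (z + 1) = Digamma z + 1 / z"
    using Digamma_plus1[OF nz] by (simp add: add.commute)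
  have s1: "(\<lambda>n. inverse (of_nat (Suc n)) - inverse (w + of_nat n)) sums
      (Digamma w + euler_mascheroni)" if "w \<noteq> 0" for w :: complex
    unfolding Digamma_def using summable_Digamma[OF that] by (simp add: sums_iff)
  have nz2: "z + 1 \<noteq> 0" "1 - z \<noteq> 0"
    using zim a by (auto simp: complex_eq_iff)
  have s3: "(\<lambda>n. (inverse (of_nat (Suc n)) - inverse (z + 1 + of_nat n)) -
      (inverse (of_nat (Suc n)) - inverse (1 - z + of_nat n))) sums
      ((Digamma (z + 1) + euler_mascheroni) - (Digamma (1 - z) + euler_mascheroni))"
    by (intro sums_diff s1 nz2)
  have s4: "(inverse (of_nat (Suc n)) - inverse (z + 1 + of_nat n)) -
      (inverse (of_nat (Suc n)) - inverse (1 - z + of_nat n))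
      = 2 * \<i> * of_real (a / (a\<^sup>2 + (real (Suc n))\<^sup>2))" for n
  proof -
    have e: "z + 1 + of_nat n \<noteq> 0" "1 - z + of_nat n \<noteq> 0"
      using zim a by (auto simp: complex_eq_iff)
    have p: "(z + 1 + of_nat n) * (1 - z + of_nat n) = of_real (a\<^sup>2 + (real (Suc n))\<^sup>2)"
      by (simp add: z_def complex_eq_iff power2_eq_square algebra_simps)
    have "(inverse (of_nat (Suc n)) - inverse (z + 1 + of_nat n)) -
      (inverse (of_nat (Suc n)) - inverse (1 - z + of_nat n)) =
       2 * z / ((z + 1 + of_nat n) * (1 - z + of_nat n))"
    proof -
      have "inverse (1 - z + of_nat n) - inverse (z + 1 + of_nat n) =
         2 * z / ((z + 1 + of_nat n) * (1 - z + of_nat n))"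
        using e by (subst division_ring_inverse_diff) (auto simp: divide_inverse)
      thus ?thesis by simp
    qed
    thus ?thesis unfolding p by (simp add: z_def)
  qed
  have s2: "(\<lambda>n. 2 * \<i> * of_real (a / (a\<^sup>2 + (real (Suc n))\<^sup>2))) sums
      (1 / z - of_real pi * cos (of_real pi * z) / sin (of_real pi * z))"
  proof -
    have "(Digamma (z + 1) + euler_mascheroni) - (Digamma (1 - z) + euler_mascheroni) =
       (Digamma z - Digamma (1 - z)) + 1 / z" unfolding dp by simp
    also have "\<dots> = 1 / z - of_real pi * cos (of_real pi * z) / sin (of_real pi * z)"
      unfolding dig by simp
    finally show ?thesis using s3 unfolding s4 by simp
  qed
  define E where "E = exp (2*pi*a)"
  have E: "E > 1" using a by (simp add: E_def)
  have cs: "cos (of_real pi * z) / sin (of_real pi * z) = - \<i> * of_real ((E + 1) / (E - 1))"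
  proof -
    define u where "u = exp (pi * a)"
    have u: "E = u * u" "u > 0" unfolding E_def u_def by (simp_all flip: exp_add)
    have v: "exp (- (pi * a)) = 1 / u" by (simp add: u_def exp_minus divide_simps)
    have eu: "exp (complex_of_real (pi * a)) = of_real u" by (simp only: exp_of_real u_def)
    have iz: "\<i> * (of_real pi * z) = of_real (- (pi * a))" "- complex_of_real (- (pi * a)) = of_real (pi * a)"
      by (simp_all add: z_def complex_eq_iff)
    have c: "cos (of_real pi * z) = of_real ((u + 1 / u) / 2)"
      unfolding cos_exp_eq mult_minus_left iz eu exp_of_real[of "- (pi * a)"] v by (simp add: complex_eq_iff)
    have s: "sin (of_real pi * z) = \<i> * of_real ((u - 1 / u) / 2)"
      unfolding sin_exp_eq mult_minus_left iz eu exp_of_real[of "- (pi * a)"] v by (simp add: complex_eq_iff diff_divide_distrib)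
    have "(u + 1 / u) / (u - 1/u) = (E + 1) / (E - 1)"
      using u E by (auto simp: divide_simps) 
    moreover have "(p / 2) / (r / 2) = p / r" for p r :: real by simp
    ultimately have "((u + 1 / u) / 2) / ((u - 1/u)/2) = (E + 1) / (E - 1)" by (simp only:)
    moreover have "of_real p / (\<i> * of_real r) = - \<i> * of_real (p / r)" for p r :: real
      by (cases "r = 0") (auto simp: field_simps)
    ultimately show ?thesis unfolding c s by (simp only:)
  qed
  have cancel: "2 * \<i> * w / (2 * \<i>) = w" for w by simp
  have "(\<lambda>n. (2 * \<i> * of_real (a / (a\<^sup>2 + (real (Suc n))\<^sup>2))) / (2 * \<i>)) sums
      ((1 / z - of_real pi * cos (of_real pi * z) / sin (of_real pi * z)) / (2 * \<i>))"
    by (rule sums_divide[OF s2])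
  also have "of_real pi * cos (of_real pi * z) / sin (of_real pi * z) = of_real pi * (- \<i> * of_real ((E + 1) / (E - 1)))"
    unfolding times_divide_eq_right[symmetric] cs ..
  also have "(1 / z - of_real pi * (- \<i> * of_real ((E + 1) / (E - 1)))) / (2 * \<i>) =
     of_real (pi * ((E + 1) / (E - 1)) / 2 - 1 / (2 * a))"
  proof -
    have "1 / z = - \<i> * of_real (1 / a)" using a by (simp add: z_def field_simps)
    moreover have "(- \<i> * of_real p - of_real pi * (- \<i> * of_real r)) / (2 * \<i>) = of_real (pi * r / 2 - p / 2)" for p r
      by (simp add: field_simps)
    ultimately show ?thesis by (simp only:) simp
  qed
  finally have "(\<lambda>n. complex_of_real (a / (a\<^sup>2 + (real (Suc n))\<^sup>2))) sums
    of_real (pi * ((E + 1) / (E - 1)) / 2 - 1 / (2 * a))" unfolding cancel .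
  hence "(\<lambda>n. a / (a\<^sup>2 + (real (Suc n))\<^sup>2)) sums (pi * ((E + 1) / (E - 1)) / 2 - 1 / (2 * a))"
    by (subst (asm) sums_of_real_iff)
  \<comment> \<open>Splitting pi/2 off (pi/2) coth(pi a) exposes the Lambert summand 1 / (exp(2 pi
    a) - 1).\<close>
  also have "pi * ((E + 1) / (E - 1)) / 2 - 1 / (2 * a) = pi / (E - 1) + pi / 2 - 1 / (2*a)"
    using E by (simp add: field_simps)
  finally show ?thesis by (simp add: E_def)
qed

section \<open>Comparison of sums with arctangent integrals\<close>

lemma arctan_increment_bounds:
  fixes a b x y :: real
  assumes "x < y" "x \<ge> 0"
  shows "(y - x) / (1 + y\<^sup>2) \<le> arctan y - arctan x" "arctan y - arctan x \<le> (y - x) / (1 + x\<^sup>2)"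
proof -
  have "\<exists>z>x. z < y \<and> arctan y - arctan x = (y - x) * (1 / (1 + z\<^sup>2))"
    by (rule MVT2[OF assms(1)]) (auto intro!: derivative_eq_intros simp: divide_simps)
  then obtain z where z: "x < z" "z < y" "arctan y - arctan x = (y - x) / (1 + z\<^sup>2)" by auto
  have "x\<^sup>2 \<le> z\<^sup>2" "z\<^sup>2 \<le> y\<^sup>2" using z assms by (auto intro!: power_mono)
  thus "(y - x) / (1 + y\<^sup>2) \<le> arctan y - arctan x" "arctan y - arctan x \<le> (y - x) / (1 + x\<^sup>2)"
    using z assms by (auto simp: z(3) intro!: divide_left_mono mult_pos_pos add_pos_nonneg)
qed

text \<open>The function 1 / (1 + s^2 x^2) decreases on [0,1] with values in [0,1], so its left and
  right Riemann sums bracket the integral and differ by at most 1/N. The error does not depend on s,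
  which makes the derivative bound in \<open>arctan_difference_sum_tendsto\<close> uniform.\<close>

lemma arctan_riemann_sum:
  fixes s :: real
  assumes s: "s > 0" and N: "N > 0"
  shows "\<bar>(\<Sum>k<N. 1 / real N / (1 + (real (Suc k) * s / real N)\<^sup>2)) - arctan s / s\<bar> \<le> 1 / real N"
proof -
  define x where "x k = real k * s / real N" for k
  have step: "x (Suc k) - x k = s / N" "x k < x (Suc k)" "x k \<ge> 0" for k
    using s N by (auto simp: x_def field_simps)
  have tele: "(\<Sum>k<N. arctan (x (Suc k)) - arctan (x k)) = arctan s"
    using N by (subst sum_lessThan_telescope) (simp add: x_def)
  have lo: "(\<Sum>k<N. s / N / (1 + (x (Suc k))\<^sup>2)) \<le> arctan s"
    unfolding tele[symmetric] using arctan_increment_bounds(1)[OF step(2,3)] step(1)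
    by (intro sum_mono) auto
  have hi: "arctan s \<le> (\<Sum>k<N. s / N / (1 + (x k)\<^sup>2))"
    unfolding tele[symmetric] using arctan_increment_bounds(2)[OF step(2,3)] step(1)
    by (intro sum_mono) auto
  have "(\<Sum>k<N. s / N / (1 + (x (Suc k))\<^sup>2)) - (\<Sum>k<N. s / N / (1 + (x k)\<^sup>2)) =
      s / N / (1 + (x N)\<^sup>2) - s / N / (1 + (x 0)\<^sup>2)"
    by (subst sum_subtractf[symmetric], subst sum_lessThan_telescope) simp
  moreover have "s / N / (1 + (x N)\<^sup>2) \<ge> 0" "s / N / (1 + (x 0)\<^sup>2) = s / N"
    using s by (auto simp: x_def)
  ultimately have "\<bar>(\<Sum>k<N. s / N / (1 + (x (Suc k))\<^sup>2)) - arctan s\<bar> \<le> s / N"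
    using lo hi by linarith
  hence "\<bar>(\<Sum>k<N. s / N / (1 + (x (Suc k))\<^sup>2)) - arctan s\<bar> / s \<le> 1 / N"
    using s by (simp add: field_simps)
  also have "\<bar>(\<Sum>k<N. s / N / (1 + (x (Suc k))\<^sup>2)) - arctan s\<bar> / s =
     \<bar>((\<Sum>k<N. s / N / (1 + (x (Suc k))\<^sup>2)) - arctan s) / s\<bar>" using s by simp
  also have "((\<Sum>k<N. s / N / (1 + (x (Suc k))\<^sup>2)) - arctan s) / s =
     (\<Sum>k<N. 1 / N / (1 + (x (Suc k))\<^sup>2)) - arctan s / s"
    using s by (simp add: diff_divide_distrib sum_divide_distrib)
  finally show ?thesis by (simp add: x_def)
qed

text \<open>Integral comparison: -arctan(a/x) is an antiderivative of a / (a^2 + x^2), so the tail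
  lies between arctan(a/(N+1)) and arctan(a/N), which differ by at most a / (a^2 + N^2).\<close>

lemma arctan_tail_bounds:
  fixes a :: real
  assumes a: "a > 0" and N: "N > 0"
  assumes S: "(\<lambda>n. a / (a\<^sup>2 + (real (Suc n))\<^sup>2)) sums S"
  shows "\<bar>S - (\<Sum>n<N. a / (a\<^sup>2 + (real (Suc n))\<^sup>2)) - arctan (a / N)\<bar> \<le> a / (real N)\<^sup>2"
proof -
  define T where "T = S - (\<Sum>n<N. a / (a\<^sup>2 + (real (Suc n))\<^sup>2))"
  have T: "(\<lambda>n. a / (a\<^sup>2 + (real (Suc (n + N)))\<^sup>2)) sums T"
    unfolding T_def using sums_iff_shift[of "\<lambda>n. a / (a\<^sup>2 + (real (Suc n))\<^sup>2)" N] S by simp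
  have bnd: "arctan (a / x) - arctan (a / (x + 1)) \<le> a / (a\<^sup>2 + x\<^sup>2)"
      "a / (a\<^sup>2 + (x + 1)\<^sup>2) \<le> arctan (a / x) - arctan (a / (x + 1))" if x: "x > 0" for x
  proof -
    have "\<exists>z>x. z < x + 1 \<and> (- arctan (a / (x + 1))) - (- arctan (a / x)) = (x + 1 - x) * (a / (a\<^sup>2 + z\<^sup>2))"
    proof (rule MVT2)
      fix z assume z: "x \<le> z" "z \<le> x + 1"
      hence "((\<lambda>x. - arctan (a / x)) has_real_derivative (- (inverse (1 + (a / z)\<^sup>2) * (- a / z\<^sup>2)))) (at z)"
        using x by (auto intro!: derivative_eq_intros simp: power2_eq_square)
      also have "- (inverse (1 + (a / z)\<^sup>2) * (- a / z\<^sup>2)) = a / (a\<^sup>2 + z\<^sup>2)"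
        using x z a by (simp add: divide_simps add_nonneg_eq_0_iff) 
      finally show "((\<lambda>x. - arctan (a / x)) has_real_derivative a / (a\<^sup>2 + z\<^sup>2)) (at z)" .
    qed simp
    then obtain z where z: "x < z" "z < x + 1" "arctan (a / x) - arctan (a / (x + 1)) = a / (a\<^sup>2 + z\<^sup>2)"
      by auto
    have "x\<^sup>2 \<le> z\<^sup>2" "z\<^sup>2 \<le> (x+1)\<^sup>2" using z x by (auto intro!: power_mono)
    thus "arctan (a / x) - arctan (a / (x + 1)) \<le> a / (a\<^sup>2 + x\<^sup>2)"
      "a / (a\<^sup>2 + (x + 1)\<^sup>2) \<le> arctan (a / x) - arctan (a / (x + 1))"
      unfolding z(3) using a x by (auto intro!: divide_left_mono mult_pos_pos add_pos_nonneg)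
  qed
  have tele: "(\<lambda>n. arctan (a / real (n + M)) - arctan (a / real (Suc n + M))) sums (arctan (a / real M) - arctan 0)" for M
  proof -
    have "(\<lambda>n. a / real (n + M)) \<longlonglongrightarrow> 0"
      by (intro real_tendsto_divide_at_top[of _ a] tendsto_const)
         (intro filterlim_compose[OF filterlim_real_sequentially] filterlim_add_const_nat_at_top)
    hence "(\<lambda>n. arctan (a / real (n + M))) \<longlonglongrightarrow> arctan 0"
      by (intro tendsto_intros)
    from telescope_sums'[OF this] show ?thesis by simp
  qed
  have up: "T \<le> arctan (a / N)"
  proof -
    have "T \<le> arctan (a / real N) - arctan 0"
    proof (rule sums_le[OF _ T tele])
      fix n show "a / (a\<^sup>2 + (real (Suc (n + N)))\<^sup>2) \<le> arctan (a / real (n + N)) - arctan (a / real (Suc n + N))"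
        using bnd(2)[of "real (n + N)"] N by (simp add: algebra_simps)
    qed
    thus ?thesis by simp
  qed
  have lo: "arctan (a / real (Suc N)) \<le> T"
  proof -
    have "arctan (a / real (Suc N)) - arctan 0 \<le> T"
    proof (rule sums_le[OF _ tele T])
      fix n show "arctan (a / real (n + Suc N)) - arctan (a / real (Suc n + Suc N)) \<le> a / (a\<^sup>2 + (real (Suc (n + N)))\<^sup>2)"
        using bnd(1)[of "real (n + Suc N)"] by (simp add: algebra_simps)
    qed
    thus ?thesis by simp
  qed
  have "arctan (a / N) - arctan (a / real (Suc N)) \<le> a / (a\<^sup>2 + (real N)\<^sup>2)"
    using bnd(1)[of "real N"] N by (simp add: algebra_simps)
  also have "\<dots> \<le> a / (real N)\<^sup>2" using a N by (intro divide_left_mono mult_pos_pos add_pos_pos) auto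
  finally show ?thesis using up lo unfolding T_def[symmetric] by linarith
qed

text \<open>Minus the logarithm of the Euler product at q = exp(-2 pi t), in the form that the
  partial fractions of coth produce.\<close>

definition lambert_log :: "real \<Rightarrow> real" where
  "lambert_log t = (\<Sum>k. 1 / (real (Suc k) * (exp (2 * pi * real (Suc k) * t) - 1)))"

text \<open>Both series are iterated sums of (q^n)^k / k: summing over k first gives the logarithms,
  over n first geometric series. The terms are nonnegative, so convergence in one order justifies
  the interchange.\<close>

lemma lambert_log_product:
  fixes t :: real
  assumes t: "t > 0"
  defines "q \<equiv> exp (- 2 * pi * t)"
  shows "(\<lambda>k. 1 / (real (Suc k) * (exp (2 * pi * real (Suc k) * t) - 1))) sums lambert_log t"
    and "(\<lambda>n. ln (1 - q ^ Suc n)) sums (- lambert_log t)"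
proof -
  have q: "0 < q" "q < 1" using t by (auto simp: q_def)
  define f where "f = (\<lambda>(n::nat,k::nat). (q ^ Suc n) ^ Suc k / real (Suc k))"
  have row: "((\<lambda>k. f (n,k)) has_sum (- ln (1 - q ^ Suc n))) UNIV" for n
  proof -
    have "q ^ Suc n < 1" using q by (intro power_Suc_less_one) auto
    hence "(\<lambda>k. - ((- (- (q ^ Suc n))) ^ k) / of_nat k) sums ln (1 + - (q ^ Suc n))"
      using q by (intro ln_series'[of "- (q ^ Suc n)"]) (simp add: abs_of_pos del: power_Suc)
    hence "(\<lambda>k. - ((- (- (q ^ Suc n))) ^ Suc k) / of_nat (Suc k)) sums ln (1 + - (q ^ Suc n))"
      by (subst sums_Suc_iff) simp
    also have "(\<lambda>k. - ((- (- (q ^ Suc n))) ^ Suc k) / of_nat (Suc k)) = (\<lambda>k. - f (n,k))"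
      unfolding f_def by (simp only: minus_minus prod.case minus_divide_left)
    finally have "(\<lambda>k. f (n,k)) sums (- ln (1 - q ^ Suc n))"
      using sums_minus by force
    thus ?thesis
      using q by (intro norm_summable_imp_has_sum) (auto simp: f_def sums_iff)
  qed
  have col: "((\<lambda>n. f (n,k)) has_sum (1 / (real (Suc k) * (exp (2 * pi * real (Suc k) * t) - 1)))) UNIV" for k
  proof -
    define r where "r = q ^ Suc k"
    have r: "0 < r" "r < 1" unfolding r_def using q by (auto intro!: mult_pos_pos power_Suc_less_one simp del: power_Suc)
    have er: "exp (2 * pi * real (Suc k) * t) = 1 / r"
    proof -
      have "r = exp (real (Suc k) * (- 2 * pi * t))" unfolding r_def q_def by (rule exp_of_nat_mult[symmetric])
      also have "real (Suc k) * (- 2 * pi * t) = - (2 * pi * real (Suc k) * t)" by (simp add: algebra_simps)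
      finally show ?thesis by (simp only: exp_minus inverse_eq_divide) simp
    qed
    have "(\<lambda>n. r * r ^ n / real (Suc k)) sums (r * (1 / (1 - r)) / real (Suc k))"
      using r by (intro sums_divide sums_mult geometric_sums) auto
    also have "(\<lambda>n. r * r ^ n / real (Suc k)) = (\<lambda>n. f (n,k))"
      by (simp add: f_def r_def fun_eq_iff flip: power_mult power_Suc power_add) (simp add: algebra_simps)
    also have "r * (1 / (1 - r)) / real (Suc k) = (1 / (real (Suc k) * (exp (2 * pi * real (Suc k) * t) - 1)))"
      unfolding er using r by (simp add: divide_simps)
    finally show ?thesis
      using q by (intro norm_summable_imp_has_sum) (auto simp: f_def sums_iff)
  qed
  have fnn: "f x \<ge> 0" for x using q by (auto simp: f_def split: prod.splits)
  have sq: "summable (\<lambda>n. - ln (1 - q ^ Suc n))"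
  proof (rule summable_comparison_test')
    show "summable (\<lambda>n. q ^ Suc n / (1 - q))"
      using q by (intro summable_divide) (simp add: summable_geometric summable_mult)
    fix n :: nat
    have a: "0 < q ^ Suc n" "q ^ Suc n < 1" using q by (auto intro!: mult_pos_pos power_Suc_less_one simp del: power_Suc)
    have "q ^ Suc n \<le> q ^ 1" using q by (intro power_decreasing) auto
    hence b: "q ^ Suc n \<le> q" by simp
    have "- ln (1 - q ^ Suc n) = ln (1 + q ^ Suc n / (1 - q ^ Suc n))"
      using a by (subst ln_inverse[symmetric]) (auto intro!: arg_cong[of _ _ ln] simp: field_simps)
    also have "\<dots> \<le> q ^ Suc n / (1 - q ^ Suc n)" using a by (intro ln_add_one_self_le_self) auto
    also have "\<dots> \<le> q ^ Suc n / (1 - q)" using a b q by (intro divide_left_mono) auto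
    finally show "norm (- ln (1 - q ^ Suc n)) \<le> q ^ Suc n / (1 - q)"
      using a by (simp del: power_Suc)
  qed
  have sumf: "f summable_on UNIV \<times> UNIV"
  proof (rule summable_on_SigmaI)
    show "((\<lambda>k. f (n, k)) has_sum - ln (1 - q ^ Suc n)) UNIV" for n by (rule row)
    have "q ^ Suc n < 1" for n using q by (intro power_Suc_less_one) auto
    hence "- ln (1 - q ^ Suc n) \<ge> 0" for n using q by (simp del: power_Suc add: ln_le_zero_iff)
    thus "(\<lambda>n. - ln (1 - q ^ Suc n)) summable_on UNIV"
      using sq by (subst summable_on_UNIV_nonneg_real_iff) (auto simp del: power_Suc)
  qed (use fnn in auto)
  then obtain T where T: "(f has_sum T) (UNIV \<times> UNIV)" by (auto simp: summable_on_def)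
  have h1: "((\<lambda>n. - ln (1 - q ^ Suc n)) has_sum T) UNIV"
    by (rule has_sum_SigmaD[OF T]) (use row in auto)
  have "((\<lambda>(k,n). f (n,k)) has_sum T) (UNIV \<times> UNIV)"
    using T by (rule iffD1[OF has_sum_swap])
  hence h2: "((\<lambda>k. 1 / (real (Suc k) * (exp (2 * pi * real (Suc k) * t) - 1))) has_sum T) UNIV"
    by (rule has_sum_SigmaD) (use col in auto)
  have h3: "(\<lambda>k. 1 / (real (Suc k) * (exp (2 * pi * real (Suc k) * t) - 1))) sums T"
    by (rule has_sum_imp_sums[OF h2])
  hence Te: "T = lambert_log t" by (simp add: lambert_log_def sums_iff)
  show "(\<lambda>k. 1 / (real (Suc k) * (exp (2 * pi * real (Suc k) * t) - 1))) sums lambert_log t"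
    using h3 Te by simp
  show "(\<lambda>n. ln (1 - q ^ Suc n)) sums (- lambert_log t)"
    using sums_minus[OF has_sum_imp_sums[OF h1]] Te by simp
qed

text \<open>The limit is the integral of arctan(v)/v from 1/t to t. Differentiating in t turns the
  two sums into Riemann sums with limits arctan(t)/t and arctan(1/t)/t, which add up to (pi/2)/t.
  The mean value theorem, started at t = 1 where both sides vanish, then gives an error
  O(1/N).\<close>

lemma arctan_difference_sum_tendsto:
  fixes t :: real
  assumes t: "t \<ge> 1"
  shows "(\<lambda>N. \<Sum>k<N. (arctan (real (Suc k) * t / N) - arctan (real (Suc k) * (1 / t) / N)) / real (Suc k))
           \<longlonglongrightarrow> pi / 2 * ln t"
proof (cases "t = 1")
  case False
  hence t1: "t > 1" using t by simp
  define F where "F N u = (\<Sum>k<N. (arctan (real (Suc k) * u / N) - arctan (real (Suc k) * (1 / u) / N)) / real (Suc k))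
     - pi / 2 * ln u" for N :: nat and u :: real
  have bound: "\<bar>F N t\<bar> \<le> (t - 1) * 2 / real N" if N: "N > 0" for N
  proof -
    define D where "D u = (\<Sum>k<N. 1 / real N / (1 + (real (Suc k) * u / N)\<^sup>2)) +
        (1 / u\<^sup>2) * (\<Sum>k<N. 1 / real N / (1 + (real (Suc k) * (1 / u) / N)\<^sup>2)) - pi / 2 / u" for u :: real
    have der: "(F N has_real_derivative D u) (at u)" if u: "u > 0" for u
    proof -
      have i: "inverse (1 + (real (Suc k) * u / N)\<^sup>2) * (real (Suc k) / N) / real (Suc k)
          = 1 / real N / (1 + (real (Suc k) * u / N)\<^sup>2)" for k u
        by (simp add: divide_inverse)
      have "(F N has_real_derivative ((\<Sum>k<N. (inverse (1 + (real (Suc k) * u / N)\<^sup>2) * (real (Suc k) / N)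
           - inverse (1 + (real (Suc k) * (1/u) / N)\<^sup>2) * (real (Suc k) * (- (1 / u\<^sup>2)) / N)) / real (Suc k))
           - pi / 2 / u)) (at u)"
        unfolding F_def using u N 
        by (auto intro!: derivative_eq_intros sum.cong simp: power2_eq_square)
      also have "(\<Sum>k<N. (inverse (1 + (real (Suc k) * u / N)\<^sup>2) * (real (Suc k) / N)
           - inverse (1 + (real (Suc k) * (1/u) / N)\<^sup>2) * (real (Suc k) * (- (1 / u\<^sup>2)) / N)) / real (Suc k))
         - pi / 2 / u = D u"
        unfolding D_def i[symmetric] sum_distrib_left sum.distrib[symmetric]
        by (intro arg_cong2[of _ _ _ _ minus] sum.cong refl) (simp add: divide_inverse algebra_simps del: of_nat_Suc)
      finally show ?thesis .
    qed
    have Db: "\<bar>D u\<bar> \<le> 2 / N" if u: "u \<ge> 1" for u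
    proof -
      define A where "A = (\<Sum>k<N. 1 / real N / (1 + (real (Suc k) * u / N)\<^sup>2))"
      define B where "B = (\<Sum>k<N. 1 / real N / (1 + (real (Suc k) * (1/u) / N)\<^sup>2))"
      have a: "\<bar>A - arctan u / u\<bar> \<le> 1 / N"
        unfolding A_def using u N by (intro arctan_riemann_sum) auto
      have b: "\<bar>B - arctan (1/u) / (1/u)\<bar> \<le> 1 / N"
        unfolding B_def using u N by (intro arctan_riemann_sum) auto
      have "\<bar>1 / u\<^sup>2 * (B - arctan (1/u) / (1/u))\<bar> \<le> 1 * (1 / N)"
        unfolding abs_mult using b u by (intro mult_mono) auto
      moreover have "D u = (A - arctan u / u) + 1 / u\<^sup>2 * (B - arctan (1/u) / (1/u))"
      proof -
        have "arctan (1 / u) = pi / 2 - arctan u"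
          using arctan_inverse[of u] u by (simp add: inverse_eq_divide)
        hence "arctan u / u + 1 / u\<^sup>2 * (arctan (1/u) / (1/u)) = pi / 2 / u"
          using u by (simp add: power2_eq_square field_simps)
        thus ?thesis unfolding D_def A_def[symmetric] B_def[symmetric]
          by (simp only: right_diff_distrib)
      qed
      ultimately show ?thesis using a by linarith
    qed
    have "\<exists>z>1. z < t \<and> F N t - F N 1 = (t - 1) * D z"
      by (rule MVT2[OF t1]) (use der in auto)
    then obtain z where z: "z > 1" "F N t - F N 1 = (t - 1) * D z" by auto
    have "F N 1 = 0" by (simp add: F_def)
    hence "\<bar>F N t\<bar> = (t - 1) * \<bar>D z\<bar>" using z t1 by (simp add: abs_mult)
    also have "\<dots> \<le> (t - 1) * (2 / N)" using Db[of z] z t1 by (intro mult_left_mono) auto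
    finally show ?thesis by simp
  qed
  have "(\<lambda>N. F N t) \<longlonglongrightarrow> 0"
  proof (rule Lim_null_comparison)
    show "\<forall>\<^sub>F N in sequentially. norm (F N t) \<le> (t - 1) * 2 / real N"
      using eventually_gt_at_top[of 0] by eventually_elim (use bound in auto)
    show "(\<lambda>N. (t - 1) * 2 / real N) \<longlonglongrightarrow> 0" by (rule lim_const_over_n)
  qed
  from tendsto_add[OF this tendsto_const[of "pi / 2 * ln t"]] show ?thesis by (simp add: F_def)
qed simp

text \<open>
  Summing \<open>t / (k\<^sup>2 t\<^sup>2 + n\<^sup>2)\<close> over the square \<open>k, n \<le> N\<close> is invariant under \<open>t \<mapsto> 1 / t\<close>;
  completing the rows to \<open>n < \<infinity>\<close> produces the Lambert series, and the two tails account for the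
  logarithm.
\<close>

lemma lambert_log_inversion_ge_1:
  fixes t :: real
  assumes t: "t \<ge> 1"
  shows "lambert_log t - lambert_log (1 / t) = pi / 12 * (1 / t - t) + ln t / 2"
proof -
  define g where "g u k n = u / ((real (Suc k) * u)\<^sup>2 + (real (Suc n))\<^sup>2)" for u :: real and k n :: nat
  \<comment> \<open>The full row sum over n, divided by k + 1. Its first part is pi times the
    Lambert summand; the part pi / (2(k+1)) cancels between t and 1/t; the last part leaves a
    multiple of 1/(k+1)^2.\<close>
  define R where "R u k = (pi / (exp (2*pi*(real (Suc k) * u)) - 1) + pi / 2 - 1 / (2*(real (Suc k) * u))) / real (Suc k)"
    for u :: real and k :: nat
  define Q where "Q u N = (\<Sum>k<N. \<Sum>n<N. g u k n)" for u N
  define Ar where "Ar u N = (\<Sum>k<N. arctan (real (Suc k) * u / N) / real (Suc k))" for u :: real and N :: nat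
  have row: "(\<lambda>n. real (Suc k) * u / ((real (Suc k) * u)\<^sup>2 + (real (Suc n))\<^sup>2)) sums (real (Suc k) * R u k)" if "u > 0" for u k
    using coth_partial_fractions[of "real (Suc k) * u"] that by (simp add: R_def)
  \<comment> \<open>The error (k+1) u / N^2 of a row becomes u / N^2 after division by k + 1, so N
    rows contribute u / N.\<close>
  have tail: "\<bar>(\<Sum>k<N. R u k) - Q u N - Ar u N\<bar> \<le> u / N" if u: "u > 0" and N: "N > 0" for u N
  proof -
    have "\<bar>R u k - (\<Sum>n<N. g u k n) - arctan (real (Suc k) * u / N) / real (Suc k)\<bar> \<le> u / (real N)\<^sup>2" for k
    proof -
      have "\<bar>real (Suc k) * R u k - (\<Sum>n<N. real (Suc k) * u / ((real (Suc k) * u)\<^sup>2 + (real (Suc n))\<^sup>2))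
           - arctan (real (Suc k) * u / N)\<bar> \<le> real (Suc k) * u / (real N)\<^sup>2"
        by (rule arctan_tail_bounds[OF _ N row]) (use u in auto)
      also have "(\<Sum>n<N. real (Suc k) * u / ((real (Suc k) * u)\<^sup>2 + (real (Suc n))\<^sup>2)) = real (Suc k) * (\<Sum>n<N. g u k n)"
        unfolding g_def sum_distrib_left by simp
      also have "real (Suc k) * R u k - real (Suc k) * (\<Sum>n<N. g u k n) - arctan (real (Suc k) * u / N)
          = real (Suc k) * (R u k - (\<Sum>n<N. g u k n) - arctan (real (Suc k) * u / N) / real (Suc k))"
        by (simp add: right_diff_distrib)
      finally have "real (Suc k) * \<bar>R u k - (\<Sum>n<N. g u k n) - arctan (real (Suc k) * u / N) / real (Suc k)\<bar>
         \<le> real (Suc k) * (u / (real N)\<^sup>2)" by (simp add: abs_mult del: of_nat_Suc)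
      thus ?thesis by (simp only: mult_le_cancel_left_pos of_nat_0_less_iff zero_less_Suc)
    qed
    hence "(\<Sum>k<N. \<bar>R u k - (\<Sum>n<N. g u k n) - arctan (real (Suc k) * u / N) / real (Suc k)\<bar>) \<le> (\<Sum>k<N. u / (real N)\<^sup>2)"
      by (intro sum_mono)
    also have "\<dots> = u / N" using N by (simp add: power2_eq_square)
    finally show ?thesis
      unfolding Q_def Ar_def sum_subtractf[symmetric]
      using sum_abs[of "\<lambda>k. R u k - (\<Sum>n<N. g u k n) - arctan (real (Suc k) * u / N) / real (Suc k)" "{..<N}"] by linarith
  qed
  have Qinv: "Q (1 / t) N = Q t N" for N
  proof -
    have "g (1 / t) k n = g t n k" for k n
    proof -
      have "(real (Suc k) * (1 / t))\<^sup>2 + (real (Suc n))\<^sup>2 = ((real (Suc k))\<^sup>2 + (real (Suc n) * t)\<^sup>2) / t\<^sup>2"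
        using t by (simp add: add_divide_distrib power_mult_distrib power_divide del: of_nat_Suc)
      hence "g (1 / t) k n = (1 / t) / (((real (Suc k))\<^sup>2 + (real (Suc n) * t)\<^sup>2) / t\<^sup>2)"
        unfolding g_def by (rule arg_cong)
      also have "\<dots> = g t n k" using t by (simp add: g_def power2_eq_square add.commute)
      finally show ?thesis .
    qed
    thus ?thesis unfolding Q_def by (subst sum.swap) simp
  qed
  have "(\<lambda>N. ((\<Sum>k<N. R t k) - Q t N - Ar t N) - ((\<Sum>k<N. R (1/t) k) - Q (1/t) N - Ar (1/t) N)) \<longlonglongrightarrow> 0 - 0"
  proof (intro tendsto_diff)
    have "(\<lambda>N. (\<Sum>k<N. R u k) - Q u N - Ar u N) \<longlonglongrightarrow> 0" if u: "u > 0" for u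
    proof (rule Lim_null_comparison)
      show "\<forall>\<^sub>F N in sequentially. norm ((\<Sum>k<N. R u k) - Q u N - Ar u N) \<le> u / real N"
        using eventually_gt_at_top[of 0] by eventually_elim (use tail u in auto)
      show "(\<lambda>N. u / real N) \<longlonglongrightarrow> 0" by (rule lim_const_over_n)
    qed
    from this[of t] this[of "1/t"] t
    show "(\<lambda>N. (\<Sum>k<N. R t k) - Q t N - Ar t N) \<longlonglongrightarrow> 0"
      "(\<lambda>N. (\<Sum>k<N. R (1/t) k) - Q (1/t) N - Ar (1/t) N) \<longlonglongrightarrow> 0" by auto
  qed
  moreover have "(\<lambda>N. Ar t N - Ar (1/t) N) \<longlonglongrightarrow> pi / 2 * ln t"
    using arctan_difference_sum_tendsto[OF t]
    by (simp add: Ar_def sum_subtractf diff_divide_distrib)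
  ultimately have "(\<lambda>N. (((\<Sum>k<N. R t k) - Q t N - Ar t N) - ((\<Sum>k<N. R (1/t) k) - Q (1/t) N - Ar (1/t) N))
      + (Ar t N - Ar (1/t) N)) \<longlonglongrightarrow> (0 - 0) + pi / 2 * ln t"
    by (rule tendsto_add)
  hence lim1: "(\<lambda>N. \<Sum>k<N. R t k - R (1/t) k) \<longlonglongrightarrow> pi / 2 * ln t"
    by (simp add: Qinv sum_subtractf)
  \<comment> \<open>The leftover terms in 1/(k+1)^2 sum to a multiple of zeta(2) = pi^2/6; this is
    the origin of the constant pi/12.\<close>
  have sq: "(\<lambda>k. 1 / (real k + 1)\<^sup>2) sums (pi\<^sup>2 / 6)"
    using inverse_squares_sums by (simp add: add.commute)
  have "(\<lambda>k. pi * (1 / (real (Suc k) * (exp (2 * pi * real (Suc k) * t) - 1)))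
       - pi * (1 / (real (Suc k) * (exp (2 * pi * real (Suc k) * (1/t)) - 1)))
       - (1 / t - t) / 2 * (1 / (real k + 1)\<^sup>2)) sums
       (pi * lambert_log t - pi * lambert_log (1/t) - (1 / t - t) / 2 * (pi\<^sup>2 / 6))"
    using t by (intro sums_diff sums_mult lambert_log_product sq) auto
  also have "(\<lambda>k. pi * (1 / (real (Suc k) * (exp (2 * pi * real (Suc k) * t) - 1)))
       - pi * (1 / (real (Suc k) * (exp (2 * pi * real (Suc k) * (1/t)) - 1)))
       - (1 / t - t) / 2 * (1 / (real k + 1)\<^sup>2)) = (\<lambda>k. R t k - R (1/t) k)"
  proof
    fix k
    define m where "m = real (Suc k)"
    define E where "E = exp (2 * pi * m * t) - 1"
    define E' where "E' = exp (2 * pi * m * (1/t)) - 1"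
    have mk: "real k + 1 = m" by (simp add: m_def)
    have m: "m > 0" by (simp add: m_def)
    have R: "R t k = (pi / E + pi / 2 - 1 / (2*(m * t))) / m"
       "R (1/t) k = (pi / E' + pi / 2 - 1 / (2*(m * (1/t)))) / m"
      by (simp_all only: R_def E_def E'_def m_def[symmetric] mult.assoc)
    show "pi * (1 / (real (Suc k) * (exp (2 * pi * real (Suc k) * t) - 1)))
       - pi * (1 / (real (Suc k) * (exp (2 * pi * real (Suc k) * (1/t)) - 1)))
       - (1 / t - t) / 2 * (1 / (real k + 1)\<^sup>2) = R t k - R (1/t) k"
      unfolding R mk m_def[symmetric] E_def[symmetric] E'_def[symmetric] using m t
      by (simp add: diff_divide_distrib add_divide_distrib power2_eq_square mult.commute)
  qed
  finally have "(\<lambda>N. \<Sum>k<N. R t k - R (1/t) k) \<longlonglongrightarrow>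
      pi * lambert_log t - pi * lambert_log (1/t) - (1 / t - t) / 2 * (pi\<^sup>2 / 6)"
    by (simp add: sums_def)
  from LIMSEQ_unique[OF this lim1]
  have "pi * (lambert_log t - lambert_log (1/t)) = pi / 2 * ln t + (1 / t - t) / 2 * (pi\<^sup>2 / 6)"
    by (simp only: right_diff_distrib)
  also have "\<dots> = pi * (pi / 12 * (1 / t - t) + ln t / 2)"
    by (simp add: algebra_simps power2_eq_square)
  finally have "pi * (lambert_log t - lambert_log (1/t)) = pi * (pi / 12 * (1 / t - t) + ln t / 2)" .
  thus ?thesis by (simp only: mult_cancel_left pi_neq_zero simp_thms) 
qed

lemma lambert_log_inversion:
  fixes t :: real
  assumes t: "t > 0"
  shows "lambert_log t - lambert_log (1 / t) = pi / 12 * (1 / t - t) + ln t / 2"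
proof (cases "t \<ge> 1")
  case False
  hence "1 / t \<ge> 1" using t by simp
  from lambert_log_inversion_ge_1[OF this] t show ?thesis
    by (simp add: ln_div right_diff_distrib)
qed (rule lambert_log_inversion_ge_1)

section \<open>The discriminant form and its coefficients\<close>

definition euler_product :: "complex \<Rightarrow> complex" where
  "euler_product q = (\<Prod>n. 1 - q ^ Suc n)"

lemma euler_product_abs_convergent:
  assumes "norm q < 1"
  shows "abs_convergent_prod (\<lambda>n. 1 - q ^ Suc n :: complex)"
proof (rule summable_imp_abs_convergent_prod)
  have "summable (\<lambda>n. norm q ^ Suc n)" using assms by (simp add: summable_geometric summable_mult)
  thus "summable (\<lambda>n. norm (1 - q ^ Suc n - 1))" by (simp add: norm_power norm_mult)
qed

lemma euler_product_holomorphic: "euler_product holomorphic_on ball 0 1"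
proof (rule holomorphic_uniform_sequence[where f = "\<lambda>N q. \<Prod>n<N. 1 - q ^ Suc n"])
  fix x :: complex assume x: "x \<in> ball 0 1"
  define r where "r = (1 + norm x) / 2"
  have r: "0 < r" "norm x < r" "r < 1" using x by (auto simp: r_def add_pos_nonneg)
  define d where "d = r - norm x"
  have d: "d > 0" using r by (simp add: d_def)
  have sub: "norm y \<le> r" if "y \<in> cball x d" for y
    using that norm_triangle_ineq[of x "y - x"] by (simp add: d_def dist_norm norm_minus_commute)
  have "uniformly_convergent_on (cball x d) (\<lambda>N q. \<Prod>n<N. 1 - q ^ Suc n)"
  proof (rule uniformly_convergent_on_prod')
    show "uniformly_convergent_on (cball x d) (\<lambda>N q. \<Sum>n<N. norm (1 - q ^ Suc n - 1 :: complex))"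
    proof (rule Weierstrass_m_test'_ev)
      show "summable (\<lambda>n. r ^ Suc n)" using r by (simp add: summable_geometric summable_mult)
      show "\<forall>\<^sub>F n in sequentially. \<forall>y\<in>cball x d. norm (norm (1 - y ^ Suc n - 1 :: complex)) \<le> r ^ Suc n"
      proof (intro always_eventually allI ballI)
        fix n y assume "y \<in> cball x d"
        hence "norm y ^ Suc n \<le> r ^ Suc n" by (intro power_mono sub) auto
        thus "norm (norm (1 - y ^ Suc n - 1 :: complex)) \<le> r ^ Suc n"
          by (simp add: norm_power norm_mult)
      qed
    qed
  qed (auto intro!: continuous_intros)
  then obtain l where l: "uniform_limit (cball x d) (\<lambda>N q. \<Prod>n<N. 1 - q ^ Suc n) l sequentially"
    by (auto simp: uniformly_convergent_on_def)
  have "l y = euler_product y" if "y \<in> cball x d" for y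
  proof -
    have "(\<lambda>N. \<Prod>n<N. 1 - y ^ Suc n) \<longlonglongrightarrow> l y" using l that by (rule tendsto_uniform_limitI)
    moreover have "(\<lambda>N. \<Prod>n<N. 1 - y ^ Suc n) \<longlonglongrightarrow> euler_product y"
      unfolding euler_product_def
    proof (subst filterlim_sequentially_Suc[symmetric], unfold lessThan_Suc_atMost, rule convergent_prod_LIMSEQ)
      show "convergent_prod (\<lambda>n. 1 - y ^ Suc n)"
        using sub[OF that] r by (intro abs_convergent_prod_imp_convergent_prod euler_product_abs_convergent) auto
    qed
    ultimately show ?thesis by (rule LIMSEQ_unique)
  qed
  with l have "uniform_limit (cball x d) (\<lambda>N q. \<Prod>n<N. 1 - q ^ Suc n) euler_product sequentially"
    by (subst uniform_limit_cong'[where g = "(\<lambda>N q. \<Prod>n<N. 1 - q ^ Suc n)" and i = l]) auto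
  moreover have "cball x d \<subseteq> ball 0 1" using sub r by fastforce
  ultimately show "\<exists>d>0. cball x d \<subseteq> ball 0 1 \<and>
      uniform_limit (cball x d) (\<lambda>N q. \<Prod>n<N. 1 - q ^ Suc n) euler_product sequentially"
    using d by blast
qed (intro open_ball holomorphic_intros)+

text \<open>L as a function of the nome. It is holomorphic at q = 0 as well, a value that no nome
  takes, so Taylor coefficients there are available.\<close>

definition disc_L :: "complex \<Rightarrow> complex" where
  "disc_L q = q * euler_product q ^ 24"

lemma disc_L_holomorphic: "disc_L holomorphic_on ball 0 1"
  unfolding disc_L_def by (intro holomorphic_intros euler_product_holomorphic)

lemma norm_nome: "norm (nome x) = exp (- 2 * pi * Im x)"
  by (simp add: nome_def)

lemma norm_nome_less_1: "Im x > 0 \<Longrightarrow> norm (nome x) < 1"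
  by (simp add: norm_nome)

lemma ramanujan_L_eq_disc_L:
  assumes "Im x > 0"
  shows "ramanujan_L x = disc_L (nome x)"
  unfolding ramanujan_L_def disc_L_def euler_product_def
  using euler_product_abs_convergent[OF norm_nome_less_1[OF assms]]
  by (subst prodinf_power) (auto intro: abs_convergent_prod_imp_convergent_prod)

text \<open>The principal logarithm supplies the preimage; the strip |Re x| <= 1/2 is where
  \<open>one_minus_nome_lower_bound\<close> applies.\<close>

lemma nome_surj:
  assumes "norm q < 1" "q \<noteq> 0"
  obtains x where "Im x > 0" "\<bar>Re x\<bar> \<le> 1 / 2" "nome x = q" "Im x = - ln (norm q) / (2 * pi)"
proof -
  define x where "x = - \<i> * Ln q / of_real (2 * pi)"
  have im: "Im x = - ln (norm q) / (2 * pi)" using assms by (simp add: x_def)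
  show ?thesis
  proof
    show "Im x > 0" unfolding im using assms by (simp add: field_simps)
    show "\<bar>Re x\<bar> \<le> 1 / 2" using mpi_less_Im_Ln[of q] Im_Ln_le_pi[of q] assms by (simp add: x_def abs_le_iff field_simps)
    show "nome x = q" using assms by (simp add: nome_def x_def)
    show "Im x = - ln (norm q) / (2 * pi)" by (fact im)
  qed
qed

text \<open>Nomes fill the punctured unit disc and the coefficient at 0 is prescribed, so any two
  candidates for the definite description are Taylor coefficients of the same function.\<close>

lemma ramanujan_tau_eqI:
  assumes "t 0 = 0" "\<And>q. norm q < 1 \<Longrightarrow> (\<lambda>m. t m * q ^ m) sums disc_L q"
  shows "ramanujan_tau = t"
  unfolding ramanujan_tau_def
proof (rule the_equality, intro conjI allI impI)
  fix x assume "Im x > 0"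
  hence "(\<lambda>m. t m * nome x ^ m) sums ramanujan_L x"
    using assms(2)[OF norm_nome_less_1] by (simp add: ramanujan_L_eq_disc_L)
  thus "(\<lambda>m. t (Suc m) * nome x ^ Suc m) sums ramanujan_L x"
    by (subst sums_Suc_iff) (simp add: assms(1))
next
  fix u assume u: "u 0 = 0 \<and> (\<forall>x. Im x > 0 \<longrightarrow> (\<lambda>m. u (Suc m) * nome x ^ Suc m) sums ramanujan_L x)"
  have "(\<lambda>m. u m * q ^ m) sums disc_L q" if q: "norm q < 1" for q
  proof (cases "q = 0")
    case False
    then obtain x where x: "Im x > 0" "nome x = q" using nome_surj[OF q] by metis
    with u have "(\<lambda>m. u (Suc m) * q ^ Suc m) sums disc_L q" using ramanujan_L_eq_disc_L[of x] by auto
    thus ?thesis using u by (subst (asm) sums_Suc_iff) simp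
  qed (use u powser_sums_zero[of u] in \<open>simp add: disc_L_def\<close>)
  hence "disc_L has_fps_expansion Abs_fps u" "disc_L has_fps_expansion Abs_fps t"
    using assms(2) by (auto intro!: has_fps_expansionI eventually_nhds_in_open[of "ball 0 1", THEN eventually_mono])
  hence "Abs_fps u = Abs_fps t" by (rule fps_expansion_unique_complex)
  thus "u = t" by (simp add: fps_eq_iff fun_eq_iff)
qed (rule assms(1))

lemma ramanujan_tau_0: "ramanujan_tau 0 = 0"
  and ramanujan_tau_sums: "norm q < 1 \<Longrightarrow> (\<lambda>m. ramanujan_tau m * q ^ m) sums disc_L q"
proof -
  define t where "t m = (deriv ^^ m) disc_L 0 / fact m" for m
  have 1: "(\<lambda>m. t m * q ^ m) sums disc_L q" if "norm q < 1" for q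
    unfolding t_def using holomorphic_power_series[OF disc_L_holomorphic, of q] that by simp
  have 2: "t 0 = 0" by (simp add: t_def disc_L_def)
  have "ramanujan_tau = t" by (rule ramanujan_tau_eqI[OF 2 1])
  thus "ramanujan_tau 0 = 0" "norm q < 1 \<Longrightarrow> (\<lambda>m. ramanujan_tau m * q ^ m) sums disc_L q"
    using 1 2 by auto
qed

lemma ramanujan_L_holomorphic: "ramanujan_L holomorphic_on {z. Im z > 0}"
proof -
  have "(disc_L \<circ> nome) holomorphic_on {z. Im z > 0}"
    by (rule holomorphic_on_compose_gen[OF _ disc_L_holomorphic])
       (auto simp: nome_def[abs_def] norm_nome_less_1[unfolded nome_def] intro!: holomorphic_intros)
  thus ?thesis by (rule holomorphic_transform) (simp add: ramanujan_L_eq_disc_L)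
qed

section \<open>The inversion formula for L\<close>

lemma ramanujan_L_imaginary_axis:
  assumes t: "t > 0"
  shows "ramanujan_L (\<i> * of_real t) = of_real (exp (- 2 * pi * t - 24 * lambert_log t))"
proof -
  define q where "q = exp (- 2 * pi * t)"
  have q: "0 < q" "q < 1" using t by (auto simp: q_def)
  have nq: "nome (\<i> * of_real t) = of_real q"
  proof -
    have "2 * of_real pi * \<i> * (\<i> * of_real t) = complex_of_real (- 2 * pi * t)"
      by (simp add: complex_eq_iff)
    thus ?thesis unfolding nome_def q_def by (simp only: exp_of_real)
  qed
  have pos: "1 - q ^ Suc n > 0" for n using q by (simp add: power_Suc_less_one del: power_Suc)
  have cp: "convergent_prod (\<lambda>n. 1 - q ^ Suc n)"
  proof (rule abs_convergent_prod_imp_convergent_prod, rule summable_imp_abs_convergent_prod)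
    have "summable (\<lambda>n. q ^ Suc n)" using q by (simp add: summable_geometric summable_mult)
    thus "summable (\<lambda>n. norm (1 - q ^ Suc n - 1))" using q by simp
  qed
  have "(\<lambda>n. 1 - q ^ Suc n) has_prod (\<Prod>n. 1 - q ^ Suc n)"
    using cp by (rule convergent_prod_has_prod)
  also have "(\<Prod>n. 1 - q ^ Suc n) = exp (\<Sum>n. ln (1 - q ^ Suc n))"
    by (rule prodinf_exp_real[OF cp pos])
  also have "(\<Sum>n. ln (1 - q ^ Suc n)) = - lambert_log t"
    using lambert_log_product(2)[OF t] by (simp add: sums_iff q_def)
  finally have "(\<lambda>n. complex_of_real (1 - q ^ Suc n)) has_prod of_real (exp (- lambert_log t))"
    by (subst has_prod_of_real_iff)
  hence "euler_product (of_real q) = of_real (exp (- lambert_log t))"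
    unfolding euler_product_def by (simp add: has_prod_iff)
  hence "ramanujan_L (\<i> * of_real t) = of_real (q * exp (- lambert_log t) ^ 24)"
    using t by (subst ramanujan_L_eq_disc_L) (simp_all add: nq disc_L_def)
  also have "q * exp (- lambert_log t) ^ 24 = exp (- 2 * pi * t - 24 * lambert_log t)"
    unfolding q_def exp_of_nat_mult[symmetric] mult_exp_exp by simp
  finally show ?thesis .
qed

lemma lambert_log_nonneg:
  assumes "t > 0"
  shows "lambert_log t \<ge> 0"
proof (rule sums_le[OF _ sums_zero lambert_log_product(1)[OF assms]])
  fix k
  have "2 * pi * real (Suc k) * t > 0" using assms by (intro mult_pos_pos) auto
  thus "0 \<le> 1 / (real (Suc k) * (exp (2 * pi * real (Suc k) * t) - 1))"
    by (intro divide_nonneg_nonneg mult_nonneg_nonneg) (simp_all del: of_nat_Suc)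
qed

text \<open>Here the exponent 24 matters: 24 (pi/12) (1/t - t) compensates exactly for the change of
  the prefactor q, and 24 (ln t)/2 becomes the factor t^12.\<close>

lemma ramanujan_L_imaginary_inversion:
  assumes t: "t > 0"
  shows "ramanujan_L (\<i> * of_real (1 / t)) = of_real t ^ 12 * ramanujan_L (\<i> * of_real t)"
proof -
  have "exp (- 2 * pi * (1 / t) - 24 * lambert_log (1 / t)) = exp (12 * ln t + (- 2 * pi * t - 24 * lambert_log t))"
      proof -
    have "24 * (lambert_log t - lambert_log (1 / t)) = 2 * pi * (1 / t) - 2 * pi * t + 12 * ln t"
      unfolding lambert_log_inversion[OF t] using t by (simp add: field_simps)
    thus ?thesis by simp
  qed
  also have "\<dots> = t ^ 12 * exp (- 2 * pi * t - 24 * lambert_log t)"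
  proof -
    have "exp (12 * ln t) = t ^ 12" using exp_of_nat_mult[of 12 "ln t"] t by simp
    thus ?thesis by (simp only: exp_add)
  qed
  finally show ?thesis using t by (simp add: ramanujan_L_imaginary_axis del: of_real_divide flip: of_real_mult of_real_power)
qed

lemma Im_minus_inverse: "Im (- 1 / z) = Im z / (norm z)\<^sup>2"
  by (simp add: Im_divide cmod_power2)

lemma ramanujan_L_inversion:
  assumes z: "Im z > 0"
  shows "ramanujan_L (- 1 / z) = z ^ 12 * ramanujan_L z"
proof -
  define S where "S = {z. Im z > 0}"
  define U where "U = (\<lambda>t. \<i> * of_real t) ` {0<..}"
  have Si: "Im (- 1 / z) > 0" if "z \<in> S" for z
    using that unfolding Im_minus_inverse by (auto simp: S_def intro!: divide_pos_pos)
  have "ramanujan_L (- 1 / z) - z ^ 12 * ramanujan_L z = 0"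
  proof (rule analytic_continuation[where f = "\<lambda>z. ramanujan_L (- 1 / z) - z ^ 12 * ramanujan_L z" and w = z and S = S and U = U and \<xi> = \<i>])
    have "(ramanujan_L \<circ> (\<lambda>z. - 1 / z)) holomorphic_on S"
      by (rule holomorphic_on_compose_gen[OF _ ramanujan_L_holomorphic])
         (use Si in \<open>auto intro!: holomorphic_intros simp: S_def\<close>)
    thus "(\<lambda>z. ramanujan_L (- 1 / z) - z ^ 12 * ramanujan_L z) holomorphic_on S"
      using ramanujan_L_holomorphic by (auto intro!: holomorphic_intros simp: S_def o_def)
    show "open S" "connected S" unfolding S_def
      by (auto simp: open_halfspace_Im_gt intro!: convex_connected convex_halfspace_Im_gt)
    show "U \<subseteq> S" "\<i> \<in> S" "z \<in> S" using z by (auto simp: U_def S_def)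
    show "\<i> islimpt U" unfolding islimpt_approachable
    proof (intro allI impI)
      fix e :: real assume e: "e > 0"
      define v where "v = \<i> * complex_of_real (1 + e / 2)"
      have "v \<in> U" unfolding U_def v_def using e by (intro imageI) auto
      moreover have d: "v - \<i> = \<i> * of_real (e / 2)" by (simp add: v_def algebra_simps)
      have "dist v \<i> = e / 2" unfolding dist_norm d norm_mult norm_of_real using e by simp
      with e have "v \<noteq> \<i>" "dist v \<i> < e" by auto
      ultimately show "\<exists>x'\<in>U. x' \<noteq> \<i> \<and> dist x' \<i> < e" by blast
    qed
    fix w assume "w \<in> U"
    then obtain t where t: "t > 0" "w = \<i> * of_real t" by (auto simp: U_def)
    have "- 1 / w = \<i> * of_real (1 / t)" using t by (simp add: field_simps)
    moreover have "w ^ 12 = of_real t ^ 12" 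
    proof -
      have "\<i> ^ 12 = (\<i>\<^sup>2) ^ 6" by (simp flip: power_mult)
      thus ?thesis by (simp add: t power_mult_distrib)
    qed
    ultimately show "ramanujan_L (- 1 / w) - w ^ 12 * ramanujan_L w = 0"
      using ramanujan_L_imaginary_inversion[OF t(1)] t(2) by simp
  qed
  thus ?thesis by simp
qed

lemma ramanujan_L_periodic: "ramanujan_L (z + of_int n) = ramanujan_L z"
proof -
  have "nome (z + of_int n) = nome z * exp (of_int (2 * n) * (of_real pi * \<i>))"
    unfolding nome_def by (simp add: algebra_simps exp_add)
  also have "exp (of_int (2 * n) * (of_real pi * \<i>)) = 1"
    using exp_integer_2pi[of "of_int n"] by (simp add: algebra_simps)
  finally show ?thesis by (simp add: ramanujan_L_def)
qed

section \<open>Growth of the discriminant form and of its coefficient sums\<close>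

lemma power_le_exp:
  fixes u :: real
  assumes "u \<ge> 0" "n > 0"
  shows "u ^ n \<le> real n ^ n * exp u"
proof -
  have "(u / n) ^ n \<le> (1 + u / n) ^ n" using assms by (intro power_mono) auto
  also have "\<dots> \<le> exp u" using assms exp_ge_one_plus_x_over_n_power_n[of n u] by simp
  finally show ?thesis using assms by (simp add: power_divide field_simps)
qed

text \<open>For Im z >= 1/2 the nome stays in the compact disc of radius exp(-pi), where the Euler
  product is bounded, and the prefactor q decays exponentially. The power 7 exceeds the invariant
  power 6 by one; \<open>ramanujan_L_bound_near_0\<close> spends the surplus.\<close>

lemma ramanujan_L_bound_high:
  obtains K where "K > 0" "\<And>z. Im z \<ge> 1 / 2 \<Longrightarrow> norm (ramanujan_L z) * Im z ^ 7 \<le> K"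
proof -
  define r where "r = exp (- pi)"
  have r: "0 < r" "r < 1" by (auto simp: r_def)
  have "continuous_on (cball 0 r) euler_product"
    by (rule holomorphic_on_imp_continuous_on, rule holomorphic_on_subset[OF euler_product_holomorphic])
       (use r in auto)
  hence "compact (euler_product ` cball 0 r)" by (intro compact_continuous_image) auto
  hence "bounded (euler_product ` cball 0 r)" by (rule compact_imp_bounded)
  then obtain B where B: "B > 0" "\<And>q. q \<in> cball 0 r \<Longrightarrow> norm (euler_product q) \<le> B"
    by (auto simp: bounded_pos)
  show ?thesis
  proof
    show "B ^ 24 * 7 ^ 7 > 0" using B by simp
    fix z :: complex assume z: "Im z \<ge> 1 / 2"
    define y where "y = Im z"
    have "- 2 * pi * y \<le> - pi" using z by (simp add: y_def)
    hence nr: "norm (nome z) \<le> r" by (simp add: norm_nome y_def r_def)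
    have "norm (euler_product (nome z)) \<le> B" by (rule B) (use nr in simp)
    hence "norm (euler_product (nome z)) ^ 24 \<le> B ^ 24" by (intro power_mono) auto
    hence 1: "norm (ramanujan_L z) \<le> exp (- 2 * pi * y) * B ^ 24"
      using z by (simp add: ramanujan_L_eq_disc_L disc_L_def norm_mult norm_power norm_nome y_def)
    have "y ^ 7 \<le> (2 * pi * y) ^ 7" 
    proof (rule power_mono)
      have "1 * y \<le> (2 * pi) * y" using z pi_gt3 by (intro mult_right_mono) (auto simp: y_def)
      thus "y \<le> 2 * pi * y" by simp
    qed (use z in \<open>simp add: y_def\<close>)
    also have "\<dots> \<le> real 7 ^ 7 * exp (2 * pi * y)"
      using z by (intro power_le_exp) (auto simp: y_def)
    finally have 2: "y ^ 7 \<le> 7 ^ 7 * exp (2 * pi * y)" by simp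
    have "norm (ramanujan_L z) * y ^ 7 \<le> (exp (- 2 * pi * y) * B ^ 24) * (7 ^ 7 * exp (2 * pi * y))"
      using 1 2 z B by (intro mult_mono) (auto simp: y_def)
    also have "\<dots> = (exp (- 2 * pi * y) * exp (2 * pi * y)) * (B ^ 24 * 7 ^ 7)" by (simp only: mult_ac)
    also have "\<dots> = B ^ 24 * 7 ^ 7" by (simp flip: exp_add)
    finally show "norm (ramanujan_L z) * Im z ^ 7 \<le> B ^ 24 * 7 ^ 7" by (simp add: y_def)
  qed
qed

lemma norm_ramanujan_L_inversion:
  assumes "Im z > 0"
  shows "norm (ramanujan_L (- 1 / z)) = norm z ^ 12 * norm (ramanujan_L z)"
  using ramanujan_L_inversion[OF assms] by (simp add: norm_mult norm_power)

text \<open>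
  \<open>|L z| (Im z)\<^sup>6\<close> is invariant under \<open>z \<mapsto> z + 1\<close> and \<open>z \<mapsto> - 1 / z\<close>. If \<open>|Re z| \<le> 1/2\<close> and
  \<open>Im z < 1/2\<close>, then \<open>z \<mapsto> - 1 / z\<close> at least doubles the imaginary part.
\<close>

lemma ramanujan_L_cusp_bound:
  obtains M where "M > 0" "\<And>z. Im z > 0 \<Longrightarrow> norm (ramanujan_L z) * Im z ^ 6 \<le> M"
proof -
  obtain K where K: "K > 0" "\<And>z. Im z \<ge> 1 / 2 \<Longrightarrow> norm (ramanujan_L z) * Im z ^ 7 \<le> K"
    using ramanujan_L_bound_high by metis
  have base: "norm (ramanujan_L z) * Im z ^ 6 \<le> 2 * K" if z: "Im z \<ge> 1 / 2" for z
  proof -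
    have "norm (ramanujan_L z) * Im z ^ 6 * (1 / 2) \<le> norm (ramanujan_L z) * Im z ^ 6 * Im z"
      using z by (intro mult_left_mono) auto
    also have "\<dots> = norm (ramanujan_L z) * Im z ^ 7" by (simp add: eval_nat_numeral)
    also have "\<dots> \<le> K" by (rule K(2)[OF z])
    finally show ?thesis by simp
  qed
  have step: "norm (ramanujan_L z) * Im z ^ 6 \<le> 2 * K" if "Im z \<ge> (1 / 2) ^ Suc n" for n z
    using that
  proof (induction n arbitrary: z)
    case (Suc n)
    show ?case
    proof (cases "Im z \<ge> 1 / 2")
      case False
      define z' where "z' = z + of_int (- round (Re z))"
      have Lz: "ramanujan_L z' = ramanujan_L z" unfolding z'_def by (rule ramanujan_L_periodic)
      have im: "Im z' = Im z" by (simp add: z'_def)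
      have "0 < (1 / 2 :: real) ^ Suc (Suc n)" by simp
      hence pos: "Im z > 0" using Suc.prems by linarith
      have re: "\<bar>Re z'\<bar> \<le> 1 / 2"
        using of_int_round_abs_le[of "Re z"] by (simp add: z'_def abs_minus_commute)
      have "(norm z')\<^sup>2 \<le> (1 / 2)\<^sup>2 + (1 / 2)\<^sup>2"
        unfolding cmod_power2 using re False pos im
        by (intro add_mono power2_le_iff_abs_le[THEN iffD2]) auto
      hence nz: "(norm z')\<^sup>2 \<le> 1 / 2" by (simp add: power2_eq_square)
      have np: "norm z' > 0" using pos im by auto
      define w where "w = - 1 / z'"
      have imw: "Im w = Im z / (norm z')\<^sup>2" unfolding w_def Im_minus_inverse im ..
      have "Im z * 2 * (norm z')\<^sup>2 \<le> Im z * 2 * (1 / 2)" using nz pos by (intro mult_left_mono) auto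
      hence "Im z * 2 \<le> Im w" unfolding imw using np by (simp add: pos_le_divide_eq)
      hence "Im w \<ge> (1 / 2) ^ Suc n" using Suc.prems by simp
      hence "norm (ramanujan_L w) * Im w ^ 6 \<le> 2 * K" by (rule Suc.IH)
      also have "norm (ramanujan_L w) = norm z' ^ 12 * norm (ramanujan_L z)"
        unfolding w_def using pos im by (subst norm_ramanujan_L_inversion) (auto simp: Lz)
      also have "Im w ^ 6 = Im z ^ 6 / norm z' ^ 12"
        unfolding imw by (simp add: power_divide flip: power_mult)
      finally show ?thesis using np by simp
    qed (rule base)
  qed (auto intro: base)
  show ?thesis
  proof
    show "2 * K > 0" using K by simp
    fix z :: complex assume z: "Im z > 0"
    obtain n where n: "(1 / 2) ^ n < Im z" using real_arch_pow_inv[OF z, of "1/2"] by auto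
    have "(1 / 2 :: real) ^ Suc n \<le> (1 / 2) ^ n" by (intro power_decreasing) auto
    thus "norm (ramanujan_L z) * Im z ^ 6 \<le> 2 * K" using n by (intro step[of n]) linarith
  qed
qed

text \<open>
  The decay of \<open>L\<close> at the cusp \<open>0\<close> gains a factor \<open>|w|\<close> over the trivial estimate; this compensates
  for the pole of \<open>1 / (1 - q)\<close> at \<open>q = 1\<close> when the coefficients are summed.
\<close>

lemma ramanujan_L_bound_near_0:
  obtains C where "C > 0" "\<And>w. Im w > 0 \<Longrightarrow> norm (ramanujan_L w) * (Im w ^ 6 * sqrt (Im w)) \<le> C * norm w"
proof -
  obtain K where K: "K > 0" "\<And>z. Im z \<ge> 1 / 2 \<Longrightarrow> norm (ramanujan_L z) * Im z ^ 7 \<le> K"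
    using ramanujan_L_bound_high by metis
  obtain M where M: "M > 0" "\<And>z. Im z > 0 \<Longrightarrow> norm (ramanujan_L z) * Im z ^ 6 \<le> M"
    using ramanujan_L_cusp_bound by metis
  show ?thesis
  proof
    show "2 * K + M > 0" using K M by simp
    fix w :: complex assume w: "Im w > 0"
    define y where "y = Im w"
    define s where "s = sqrt y"
    define L where "L = norm (ramanujan_L w)"
    have s: "s > 0" "s * s = y" using w by (auto simp: s_def y_def)
    have nw: "norm w > 0" using w by auto
    have L0: "L \<ge> 0" by (simp add: L_def)
    have "L * (y ^ 6 * s) \<le> (2 * K + M) * norm w"
    \<comment> \<open>The condition describes a disc tangent to the real axis at 0, that is Im(-1/w)
      >= 1/2. There the bound with power 7, taken at -1/w, gives \<open>L * y ^ 7\<close> <= K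
      |w|^2, and |w| <= 2 \<open>s\<close> trades one factor |w| for \<open>s\<close>.\<close>
    proof (cases "(norm w)\<^sup>2 \<le> 2 * y")
      case True
      have "(norm w)\<^sup>2 \<le> (2 * s)\<^sup>2" 
      proof -
        have "(2 * s)\<^sup>2 = 4 * y" using s by (simp add: power2_eq_square)
        thus ?thesis using True w by (simp add: y_def)
      qed
      hence ws: "norm w \<le> 2 * s" by (rule power2_le_imp_le) (use s in simp)
      have "Im (- 1 / w) \<ge> 1 / 2" unfolding Im_minus_inverse using True nw by (simp add: y_def field_simps)
      from K(2)[OF this] have "norm w ^ 12 * L * (y / (norm w)\<^sup>2) ^ 7 \<le> K"
        unfolding Im_minus_inverse norm_ramanujan_L_inversion[OF w] L_def y_def .
      also have "norm w ^ 12 * L * (y / (norm w)\<^sup>2) ^ 7 = L * y ^ 7 / (norm w)\<^sup>2"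
        using nw by (simp add: power_divide field_simps flip: power_mult power_add)
      finally have 1: "L * y ^ 7 \<le> K * (norm w * norm w)" using nw by (simp add: field_simps power2_eq_square)
      have "L * (y ^ 6 * s) * s = L * y ^ 7" using s by (simp add: eval_nat_numeral mult_ac)
      also note 1
      also have "K * (norm w * norm w) \<le> K * (norm w * (2 * s))"
        using ws nw K by (intro mult_left_mono) auto
      finally have "L * (y ^ 6 * s) * s \<le> (2 * K * norm w) * s" by (simp only: mult_ac)
      hence "L * (y ^ 6 * s) \<le> 2 * K * norm w" using s(1) by (simp only: mult_le_cancel_right_pos)
      also have "\<dots> \<le> (2 * K + M) * norm w" using M nw by (intro mult_right_mono) auto
      finally show ?thesis .
    next
      case False
      \<comment> \<open>Outside that disc sqrt(Im w) <= |w|, so the invariant bound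
        suffices.\<close>
      have "s\<^sup>2 \<le> (norm w)\<^sup>2" using False s w by (simp add: power2_eq_square y_def)
      hence ws: "s \<le> norm w" by (rule power2_le_imp_le) simp
      have "L * (y ^ 6 * s) = (L * y ^ 6) * s" by simp
      also have "\<dots> \<le> M * norm w"
        using M(2)[OF w] ws s M(1) by (intro mult_mono) (auto simp: L_def y_def)
      also have "\<dots> \<le> (2 * K + M) * norm w" using K nw by (intro mult_right_mono) auto
      finally show ?thesis .
    qed
    thus "norm (ramanujan_L w) * (Im w ^ 6 * sqrt (Im w)) \<le> (2 * K + M) * norm w"
      by (simp add: L_def y_def s_def)
  qed
qed

text \<open>On the rectangle |Re w| <= 1/2, 0 <= Im w <= 1 the only zero of 1 - q is w = 0, and it
  is simple. The quotient by w, extended by its limit -2 pi i, is continuous and zero-free on this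
  compact set; its minimum modulus serves as c.\<close>

lemma one_minus_nome_lower_bound:
  obtains c where "c > 0" "\<And>w. \<bar>Re w\<bar> \<le> 1 / 2 \<Longrightarrow> 0 \<le> Im w \<Longrightarrow> Im w \<le> 1 \<Longrightarrow> c * norm w \<le> norm (1 - nome w)"
proof -
  define D where "D = 2 * of_real pi * \<i>"
  define S where "S = cbox (Complex (-1/2) 0) (Complex (1/2) 1)"
  define h where "h w = (if w = 0 then - D else (1 - nome w) / w)" for w
  have n0: "nome 0 = 1" by (simp add: nome_def)
  have "isCont h w" for w
  proof (cases "w = 0")
    case True
    have "(nome has_field_derivative D) (at 0)"
      unfolding nome_def[abs_def] D_def by (auto intro!: derivative_eq_intros)
    hence "((\<lambda>w. - ((nome w - nome 0) / (w - 0))) \<longlongrightarrow> - D) (at 0)"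
      unfolding has_field_derivative_iff by (rule tendsto_minus)
    moreover have "\<forall>\<^sub>F w in at 0. - ((nome w - nome 0) / (w - 0)) = h w"
      unfolding eventually_at_filter by (rule always_eventually) (auto simp: h_def n0 field_simps)
    ultimately have "(h \<longlongrightarrow> - D) (at 0)" by (rule Lim_transform_eventually)
    thus ?thesis by (simp add: isCont_def True h_def)
  next
    case False
    have "isCont (\<lambda>w. (1 - nome w) / w) w"
      unfolding nome_def using False by (auto intro!: continuous_intros)
    moreover have "\<forall>\<^sub>F v in nhds w. (1 - nome v) / v = h v"
      using t1_space_nhds[OF False] by eventually_elim (auto simp: h_def)
    ultimately show ?thesis by (subst (asm) isCont_cong) auto
  qed
  hence cont: "continuous_on S (\<lambda>w. norm (h w))"
    by (intro continuous_on_norm continuous_at_imp_continuous_on) auto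
  have memS: "w \<in> S \<longleftrightarrow> \<bar>Re w\<bar> \<le> 1/2 \<and> 0 \<le> Im w \<and> Im w \<le> 1" for w
    by (auto simp: S_def in_cbox_complex_iff abs_le_iff)
  have "compact S" "S \<noteq> {}" using memS[of 0] by (auto simp: S_def)
  from continuous_attains_inf[OF this cont]
  obtain m where m: "m \<in> S" "\<And>w. w \<in> S \<Longrightarrow> norm (h m) \<le> norm (h w)" by auto
  have hm: "h m \<noteq> 0"
  proof
    assume 0: "h m = 0"
    hence "m \<noteq> 0" by (auto simp: h_def D_def split: if_splits)
    hence "nome m = 1" using 0 by (simp add: h_def)
    then obtain n :: int where n: "Im m = 0" "Re m = of_int n"
      unfolding nome_def exp_eq_1 by auto
    have "\<bar>real_of_int n\<bar> \<le> 1 / 2" using m(1) n by (simp add: memS)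
    hence "n = 0" by linarith
    thus False using n \<open>m \<noteq> 0\<close> by (simp add: complex_eq_iff)
  qed
  show ?thesis
  proof
    show "norm (h m) > 0" using hm by simp
    fix w :: complex assume w: "\<bar>Re w\<bar> \<le> 1 / 2" "0 \<le> Im w" "Im w \<le> 1"
    show "norm (h m) * norm w \<le> norm (1 - nome w)"
    proof (cases "w = 0")
      case False
      have "norm (h m) \<le> norm (h w)" by (rule m(2)) (use w memS in auto)
      thus ?thesis using False by (simp add: h_def norm_divide field_simps)
    qed simp
  qed
qed

section \<open>Partial sums of the coefficients\<close>

definition tau_sum :: "nat \<Rightarrow> complex" where
  "tau_sum n = (\<Sum>k\<le>n. ramanujan_tau k)"

lemma tau_sum_0: "tau_sum 0 = 0"
  by (simp add: tau_sum_def ramanujan_tau_0)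

lemma tau_sum_Suc: "tau_sum (Suc n) - tau_sum n = ramanujan_tau (Suc n)"
  by (simp add: tau_sum_def)

text \<open>Cauchy's inequality at radius exp(-2 pi / n), that is at Im w = 1/n, costs only the
  constant exp(2 pi). On that circle |\<open>disc_L q\<close>| <= C |w| n^(13/2) and |1 - q| >= c
  |w|, so |w| cancels.\<close>

lemma tau_sum_bound:
  obtains C where "C > 0" "\<And>n. n > 0 \<Longrightarrow> norm (tau_sum n) \<le> C * real n powr (13 / 2)"
proof -
  obtain C where C: "C > 0" "\<And>w. Im w > 0 \<Longrightarrow> norm (ramanujan_L w) * (Im w ^ 6 * sqrt (Im w)) \<le> C * norm w"
    using ramanujan_L_bound_near_0 by metis
  obtain c where c: "c > 0" "\<And>w. \<bar>Re w\<bar> \<le> 1 / 2 \<Longrightarrow> 0 \<le> Im w \<Longrightarrow> Im w \<le> 1 \<Longrightarrow> c * norm w \<le> norm (1 - nome w)"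
    using one_minus_nome_lower_bound by metis
  define g where "g q = disc_L q / (1 - q)" for q
  have ghol: "g holomorphic_on ball 0 1"
    unfolding g_def by (intro holomorphic_intros disc_L_holomorphic) auto
  define b where "b n = (deriv ^^ n) g 0 / fact n" for n
  have bsums: "(\<lambda>n. b n * q ^ n) sums g q" if "norm q < 1" for q
    unfolding b_def using holomorphic_power_series[OF ghol, of q] that by simp
  \<comment> \<open>Multiplying \<open>g\<close> by 1 - q takes first differences of its Taylor
    coefficients; uniqueness of tau therefore makes \<open>b\<close> the sequence of partial
    sums.\<close>
  have tau: "ramanujan_tau = (\<lambda>n. b n - (if n = 0 then 0 else b (n - 1)))"
  proof (rule ramanujan_tau_eqI)
    show "b 0 - (if 0 = (0::nat) then 0 else b (0 - 1)) = 0" by (simp add: b_def g_def disc_L_def)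
    fix q :: complex assume q: "norm q < 1"
    have "(\<lambda>n. (if Suc n = 0 then 0 else b (Suc n - 1)) * q ^ Suc n) sums (q * g q)"
      using sums_mult[OF bsums[OF q], of q] by (simp add: mult_ac)
    hence "(\<lambda>n. (if n = 0 then 0 else b (n - 1)) * q ^ n) sums (q * g q)"
      by (subst (asm) sums_Suc_iff) simp
    from sums_diff[OF bsums[OF q] this]
    have "(\<lambda>n. (b n - (if n = 0 then 0 else b (n - 1))) * q ^ n) sums (g q - q * g q)"
      by (simp only: left_diff_distrib)
    also have "g q - q * g q = (1 - q) * g q" by (simp add: algebra_simps)
    also have "\<dots> = disc_L q" using q by (auto simp: g_def)
    finally show "(\<lambda>n. (b n - (if n = 0 then 0 else b (n - 1))) * q ^ n) sums disc_L q" .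
  qed
  have T: "tau_sum n = b n" for n
    unfolding tau_sum_def by (induction n) (simp_all add: tau)
  show ?thesis
  proof
    show "C / c * exp (2 * pi) > 0" using C c by simp
    fix n :: nat assume n: "n > 0"
    define y where "y = 1 / real n"
    define r where "r = exp (- 2 * pi * y)"
    have y: "0 < y" "y \<le> 1" using n by (auto simp: y_def)
    have r: "0 < r" "r < 1" using y by (auto simp: r_def)
    define B where "B = C / c * real n powr (13 / 2)"
    have "norm ((deriv ^^ n) g 0) \<le> fact n * B / r ^ n"
    proof (rule Cauchy_inequality)
      show "g holomorphic_on ball 0 r" "continuous_on (cball 0 r) g"
        using r by (auto intro!: holomorphic_on_imp_continuous_on intro: holomorphic_on_subset[OF ghol])
      fix q :: complex assume "norm (0 - q) = r"
      hence nq: "norm q = r" by simp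
      hence q01: "norm q < 1" "q \<noteq> 0" using r by auto
      obtain w where w: "Im w > 0" "\<bar>Re w\<bar> \<le> 1 / 2" "nome w = q" "Im w = - ln (norm q) / (2 * pi)"
        by (rule nome_surj[OF q01])
      have yw: "Im w = y" using w(4) by (simp add: nq r_def)
      have nw: "norm w > 0" using w(1) by auto
      have "y ^ 6 * sqrt y * real n powr (13 / 2) = (y powr 6 * y powr (1 / 2)) * real n powr (13/2)"
        using y by (simp add: powr_half_sqrt)
      also have "\<dots> = y powr (13 / 2) * real n powr (13 / 2)" by (simp flip: powr_add)
      also have "\<dots> = (y * real n) powr (13 / 2)" using y by (simp add: powr_mult)
      also have "\<dots> = 1" using n by (simp add: y_def)
      finally have yn: "y ^ 6 * sqrt y * real n powr (13 / 2) = 1" .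
      have "norm (disc_L q) = norm (ramanujan_L w)" using w by (simp add: ramanujan_L_eq_disc_L)
      hence "norm (disc_L q) * (y ^ 6 * sqrt y) \<le> C * norm w" using C(2)[OF w(1)] yw by simp
      hence "norm (disc_L q) * (y ^ 6 * sqrt y) * real n powr (13/2) \<le> C * norm w * real n powr (13/2)"
        by (intro mult_right_mono) auto
      hence 1: "norm (disc_L q) \<le> C * norm w * real n powr (13/2)" 
        using yn by (simp add: mult.assoc)
      have 2: "c * norm w \<le> norm (1 - q)" using c(2)[of w] w y yw by simp
      have "norm (g q) \<le> (C * norm w * real n powr (13/2)) / (c * norm w)"
        unfolding g_def norm_divide using 1 2 c nw C by (intro frac_le) auto
      also have "\<dots> = B" using nw by (simp add: B_def)
      finally show "norm (g q) \<le> B" .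
    qed (use r in auto)
    moreover have "r ^ n = exp (- 2 * pi)"
      unfolding r_def exp_of_nat_mult[symmetric] using n by (simp add: y_def)
    ultimately have "norm (b n) \<le> B * exp (2 * pi)"
      by (simp add: b_def norm_divide field_simps exp_minus)
    thus "norm (tau_sum n) \<le> C / c * exp (2 * pi) * real n powr (13 / 2)"
      by (simp add: T B_def mult_ac)
  qed
qed

section \<open>Dirichlet series with bounded partial sums\<close>

text \<open>Mean value estimate on the segment from n to n + 1: differencing gains one power of n.
  For Re x >= -1 the derivative is largest at the left end.\<close>

lemma norm_nat_powr_diff_le:
  assumes n: "n > 0" and x: "Re x \<ge> - 1"
  shows "norm (of_nat n powr (- x) - of_nat (Suc n) powr (- x) :: complex) \<le> norm x * real n powr (- Re x - 1)"
proof -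
  define S where "S = (of_real ` {real n..real (Suc n)} :: complex set)"
  have "norm (of_nat n powr (- x) - of_nat (Suc n) powr (- x) :: complex)
      \<le> (norm x * real n powr (- Re x - 1)) * norm (of_nat n - of_nat (Suc n) :: complex)"
  proof (rule field_differentiable_bound[where S = S])
    show "convex S" unfolding S_def
      by (intro convex_linear_image bounded_linear.linear bounded_linear_of_real convex_real_interval)
    have "of_nat m \<in> S" if "m = n \<or> m = Suc n" for m
      unfolding S_def by (rule image_eqI[of _ _ "real m"]) (use that in auto)
    thus "of_nat n \<in> S" "of_nat (Suc n) \<in> S" by blast+
    fix z assume "z \<in> S"
    then obtain u where u: "z = of_real u" "real n \<le> u" by (auto simp: S_def)
    hence u0: "u > 0" using n by simp
    have "z \<notin> \<real>\<^sub>\<le>\<^sub>0" using u u0 by (simp add: complex_nonpos_Reals_iff)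
    thus "((\<lambda>z. z powr (- x)) has_field_derivative (- x) * z powr (- x - 1)) (at z within S)"
      by (rule has_field_derivative_at_within[OF has_field_derivative_powr])
    have "norm (z powr (- x - 1)) = u powr (- Re x - 1)"
      using u0 norm_powr_real_powr[of z "- x - 1"] by (simp add: u)
    also have "\<dots> \<le> real n powr (- Re x - 1)" using u n x by (intro powr_mono2') auto
    finally show "norm ((- x) * z powr (- x - 1)) \<le> norm x * real n powr (- Re x - 1)"
      unfolding norm_mult by (simp add: mult_left_mono)
  qed
  also have "norm (of_nat n - of_nat (Suc n) :: complex) = 1" by simp
  finally show ?thesis by simp
qed

lemma dirichlet_series_summation_by_parts:
  fixes B :: "nat \<Rightarrow> complex"
  assumes B0: "B 0 = 0"
  shows "(\<Sum>l<Suc N. (B (Suc l) - B l) * of_nat (Suc l) powr (- x)) =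
     B (Suc N) * of_nat (Suc N) powr (- x) +
     (\<Sum>l<N. B (Suc l) * (of_nat (Suc l) powr (- x) - of_nat (Suc (Suc l)) powr (- x)))"
proof (induction N)
  case (Suc N)
  show ?case
    unfolding sum.lessThan_Suc[of _ "Suc N"] Suc unfolding sum.lessThan_Suc[of _ N] by (simp only: algebra_simps)
qed (simp add: B0)

text \<open>Abel summation replaces the terms by \<open>B\<close> times differences of powers, of
  size |x| n^(\<sigma> - Re x - 1) up to a constant. These are absolutely summable, locally
  uniformly in x, so the limit is holomorphic even where the original series need not converge
  absolutely; the boundary term tends to 0.\<close>

lemma dirichlet_series_of_bounded_sums:
  fixes B :: "nat \<Rightarrow> complex" and C \<sigma> :: real
  assumes B0: "B 0 = 0" and C: "C > 0" and s0: "\<sigma> \<ge> 0"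
    and B: "\<And>n. n > 0 \<Longrightarrow> norm (B n) \<le> C * real n powr \<sigma>"
  obtains F where "F holomorphic_on {x. Re x > \<sigma>}"
    "\<And>x. Re x > \<sigma> \<Longrightarrow> (\<lambda>l. (B (Suc l) - B l) * of_nat (Suc l) powr (- x)) sums F x"
proof
  define U where "U l x = B (Suc l) * (of_nat (Suc l) powr (- x) - of_nat (Suc (Suc l)) powr (- x))" for l x
  define F where "F x = (\<Sum>l. U l x)" for x
  define S where "S = {x::complex. Re x > \<sigma>}"
  have Sopen: "open S" unfolding S_def by (rule open_halfspace_Re_gt)
  have unif: "\<exists>d>0. cball x d \<subseteq> S \<and> uniform_limit (cball x d) (\<lambda>N x. \<Sum>l<N. U l x) F sequentially" if x: "x \<in> S" for x
  proof -
    \<comment> \<open>Half the distance to the line Re x = \<sigma>: on the closed disc Re y >=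
      \<sigma> + d, which leaves the summable exponent -1 - d.\<close>
    define d where "d = (Re x - \<sigma>) / 2"
    define R where "R = norm x + d"
    have d: "d > 0" using x by (simp add: d_def S_def)
    have yb: "Re y \<ge> \<sigma> + d" "norm y \<le> R" if "y \<in> cball x d" for y
    proof -
      have n: "norm (x - y) \<le> d" using that by (simp add: dist_norm)
      have "Re (x - y) \<le> norm (x - y)" by (rule complex_Re_le_cmod)
      thus "Re y \<ge> \<sigma> + d" using n by (simp add: d_def field_simps)
      show "norm y \<le> R" using n norm_triangle_ineq2[of y x] by (simp add: R_def norm_minus_commute)
    qed
    have "uniform_limit (cball x d) (\<lambda>N x. \<Sum>l<N. U l x) (\<lambda>x. \<Sum>l. U l x) sequentially"
    proof (rule Weierstrass_m_test)
      have "summable (\<lambda>l. real l powr (- 1 - d))" using d by (subst summable_real_powr_iff) simp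
      hence "summable (\<lambda>l. real (Suc l) powr (- 1 - d))" by (subst summable_Suc_iff)
      thus "summable (\<lambda>l. C * R * real (Suc l) powr (- 1 - d))" by (rule summable_mult)
      fix l y assume y: "y \<in> cball x d"
      have "norm (U l y) \<le> (C * real (Suc l) powr \<sigma>) * (norm y * real (Suc l) powr (- Re y - 1))"
        unfolding U_def norm_mult using yb(1)[OF y] d s0 C
        by (intro mult_mono B norm_nat_powr_diff_le) auto
      also have "\<dots> \<le> (C * real (Suc l) powr \<sigma>) * (R * real (Suc l) powr (- (\<sigma> + d) - 1))"
        using yb[OF y] C order_trans[OF norm_ge_zero yb(2)[OF y]] by (intro mult_left_mono mult_mono powr_mono) auto
      also have "\<dots> = C * R * (real (Suc l) powr \<sigma> * real (Suc l) powr (- (\<sigma> + d) - 1))" by (simp only: mult_ac)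
      also have "real (Suc l) powr \<sigma> * real (Suc l) powr (- (\<sigma> + d) - 1) = real (Suc l) powr (- 1 - d)"
        by (subst powr_add[symmetric]) (simp add: algebra_simps)
      finally show "norm (U l y) \<le> C * R * real (Suc l) powr (- 1 - d)" .
    qed
    moreover have "cball x d \<subseteq> S" using yb(1) d by (fastforce simp: S_def)
    ultimately show ?thesis using d unfolding F_def[abs_def] by blast
  qed
  show "F holomorphic_on {x. Re x > \<sigma>}"
    unfolding S_def[symmetric]
  proof (rule holomorphic_uniform_sequence[OF Sopen _ unif])
    show "(\<lambda>x. \<Sum>l<N. U l x) holomorphic_on S" for N
      unfolding U_def by (intro holomorphic_intros)
  qed
  fix x assume x: "Re x > \<sigma>"
  have "(\<lambda>N. \<Sum>l<N. U l x) \<longlonglongrightarrow> F x"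
  proof -
    obtain d where d: "d > 0" "uniform_limit (cball x d) (\<lambda>N x. \<Sum>l<N. U l x) F sequentially"
      using unif[of x] x by (auto simp: S_def)
    show ?thesis by (rule tendsto_uniform_limitI[OF d(2)]) (use d(1) in simp)
  qed
  moreover have "(\<lambda>N. B (Suc N) * of_nat (Suc N) powr (- x)) \<longlonglongrightarrow> 0"
  proof (rule Lim_null_comparison)
    show "\<forall>\<^sub>F N in sequentially. norm (B (Suc N) * of_nat (Suc N) powr (- x)) \<le> C * real (Suc N) powr (\<sigma> - Re x)"
    proof (intro always_eventually allI)
      fix N
      have "norm (of_nat (Suc N) powr (- x) :: complex) = real (Suc N) powr (- Re x)"
        using norm_powr_real_powr[of "of_nat (Suc N)" "- x"] by simp
      hence "norm (B (Suc N) * of_nat (Suc N) powr (- x)) \<le> C * real (Suc N) powr \<sigma> * real (Suc N) powr (- Re x)"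
        using B[of "Suc N"] by (simp only: norm_mult) (intro mult_right_mono, auto)
      also have "\<dots> = C * real (Suc N) powr (\<sigma> - Re x)" by (simp add: powr_diff powr_minus divide_inverse)
      finally show "norm (B (Suc N) * of_nat (Suc N) powr (- x)) \<le> C * real (Suc N) powr (\<sigma> - Re x)" .
    qed
    have "(\<lambda>N. real N powr (\<sigma> - Re x)) \<longlonglongrightarrow> 0"
      using x by (intro tendsto_neg_powr filterlim_real_sequentially) auto
    hence "(\<lambda>N. C * real (Suc N) powr (\<sigma> - Re x)) \<longlonglongrightarrow> C * 0"
      by (intro tendsto_mult tendsto_const) (rule filterlim_sequentially_Suc[THEN iffD2])
    thus "(\<lambda>N. C * real (Suc N) powr (\<sigma> - Re x)) \<longlonglongrightarrow> 0" by simp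
  qed
  ultimately have "(\<lambda>N. B (Suc N) * of_nat (Suc N) powr (- x) + (\<Sum>l<N. U l x)) \<longlonglongrightarrow> 0 + F x"
    by (intro tendsto_add)
  hence "(\<lambda>N. \<Sum>l<Suc N. (B (Suc l) - B l) * of_nat (Suc l) powr (- x)) \<longlonglongrightarrow> F x"
    unfolding dirichlet_series_summation_by_parts[where B = B, OF B0] U_def by simp
  thus "(\<lambda>l. (B (Suc l) - B l) * of_nat (Suc l) powr (- x)) sums F x"
    unfolding sums_def by (subst (asm) filterlim_sequentially_Suc)
qed

lemma ramanujan_zeta_series_holomorphic: "ramanujan_zeta_series holomorphic_on {x. Re x > 13 / 2}"
proof -
  obtain C where C: "C > 0" "\<And>n. n > 0 \<Longrightarrow> norm (tau_sum n) \<le> C * real n powr (13 / 2)"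
    using tau_sum_bound by metis
  obtain F where F: "F holomorphic_on {x. Re x > 13 / 2}"
    "\<And>x. Re x > 13 / 2 \<Longrightarrow> (\<lambda>l. (tau_sum (Suc l) - tau_sum l) * of_nat (Suc l) powr (- x)) sums F x"
    using dirichlet_series_of_bounded_sums[of tau_sum C "13/2"] C tau_sum_0 by auto
  show ?thesis
  proof (rule holomorphic_transform[OF F(1)])
    fix x :: complex assume "x \<in> {x. Re x > 13 / 2}"
    with F(2)[of x] show "F x = ramanujan_zeta_series x"
      unfolding tau_sum_Suc ramanujan_zeta_series_def by (simp add: sums_iff)
  qed
qed

text \<open>A coefficient is a difference of consecutive partial sums. This is cruder than the
  O(n^6) obtainable from the cusp bound, and it is why termwise integration starts at Re x >
  15/2.\<close>

lemma ramanujan_tau_bound: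
  obtains C where "C > 0" "\<And>n. n > 0 \<Longrightarrow> norm (ramanujan_tau n) \<le> C * real n powr (13 / 2)"
proof -
  obtain C where C: "C > 0" "\<And>n. n > 0 \<Longrightarrow> norm (tau_sum n) \<le> C * real n powr (13 / 2)"
    using tau_sum_bound by metis
  show ?thesis
  proof
    show "2 * C > 0" using C by simp
    fix n :: nat assume "n > 0"
    then obtain m where m: "n = Suc m" by (cases n) auto
    have "norm (tau_sum m) \<le> C * real n powr (13 / 2)"
    proof (cases "m = 0")
      case False
      hence "norm (tau_sum m) \<le> C * real m powr (13 / 2)" using C by simp
      also have "\<dots> \<le> C * real n powr (13 / 2)" using C m by (intro mult_left_mono powr_mono2) auto
      finally show ?thesis .
    qed (use C in \<open>simp add: tau_sum_0\<close>)
    moreover have "norm (tau_sum n) \<le> C * real n powr (13 / 2)" using C(2)[of n] m by simp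
    ultimately show "norm (ramanujan_tau n) \<le> 2 * C * real n powr (13 / 2)"
      using norm_triangle_ineq4[of "tau_sum n" "tau_sum m"] tau_sum_Suc[of m] by (simp add: m)
  qed
qed

section \<open>The even power series\<close>

definition axis_L :: "real \<Rightarrow> real" where
  "axis_L t = exp (- 2 * pi * t - 24 * lambert_log t)"

lemma ramanujan_L_axis: "t > 0 \<Longrightarrow> ramanujan_L (\<i> * of_real t) = of_real (axis_L t)"
  unfolding axis_L_def by (rule ramanujan_L_imaginary_axis)

lemma axis_L_pos: "axis_L t > 0"
  by (simp add: axis_L_def)

lemma axis_L_inversion:
  assumes "t > 0"
  shows "axis_L (1 / t) = t ^ 12 * axis_L t"
proof -
  have "complex_of_real (axis_L (1 / t)) = of_real (t ^ 12 * axis_L t)"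
    using ramanujan_L_imaginary_inversion[OF assms] assms ramanujan_L_axis[of t] ramanujan_L_axis[of "1 / t"] by simp
  thus ?thesis by (simp only: of_real_eq_iff)
qed

lemma axis_L_le: "t > 0 \<Longrightarrow> axis_L t \<le> exp (- 2 * pi * t)"
  using lambert_log_nonneg[of t] by (simp add: axis_L_def)

lemma continuous_on_axis_L: "continuous_on {0<..} axis_L"
proof -
  have "continuous_on {0<..} (\<lambda>t. Re (ramanujan_L (\<i> * of_real t)))"
    by (intro continuous_intros continuous_on_compose2[OF holomorphic_on_imp_continuous_on[OF ramanujan_L_holomorphic]]) auto
  also have "?this \<longleftrightarrow> continuous_on {0<..} axis_L"
    by (intro continuous_on_cong) (auto simp: ramanujan_L_axis)
  finally show ?thesis .
qed

text \<open>Inversion turns the exponential decay at infinity into a bound exp(-2 pi / t) t^(-12)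
  near 0, which beats every negative power of t. Hence the integrals over (0,1) converge for all
  complex exponents.\<close>

lemma axis_L_rapid_decay:
  fixes p :: real
  obtains K where "\<And>t. 0 < t \<Longrightarrow> t < 1 \<Longrightarrow> axis_L t * t powr p \<le> K"
proof
  \<comment> \<open>m >= -p makes the final exponent m + p nonnegative; the extra 12 in
    \<open>n\<close> absorbs the factor t^12 of the inversion formula.\<close>
  define m where "m = nat \<lceil>- p\<rceil>"
  define n where "n = m + 12"
  fix t :: real assume t: "0 < t" "t < 1"
  have n: "n > 0" by (simp add: n_def)
  have "(1 / t) ^ n \<le> real n ^ n * exp (1 / t)" using t n by (intro power_le_exp) auto
  hence "exp (- (1 / t)) \<le> real n ^ n * t ^ n"
    using t by (simp add: exp_minus field_simps power_divide)
  moreover have "- 2 * pi * (1 / t) \<le> - (1 / t)"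
  proof -
    have "1 * (1 / t) \<le> 2 * pi * (1 / t)" using t pi_gt3 by (intro mult_right_mono) auto
    thus ?thesis by simp
  qed
  hence "exp (- 2 * pi * (1 / t)) \<le> exp (- (1 / t))" by (simp only: exp_le_cancel_iff)
  moreover have "axis_L (1 / t) \<le> exp (- 2 * pi * (1 / t))" by (rule axis_L_le) (use t in simp)
  ultimately have 1: "axis_L (1 / t) \<le> real n ^ n * t ^ n"
    by (meson order_trans)
  have "t ^ 12 * axis_L t \<le> t ^ 12 * (real n ^ n * t ^ m)"
    using 1 unfolding axis_L_inversion[OF t(1)] by (simp add: n_def power_add mult_ac)
  hence "axis_L t \<le> real n ^ n * t ^ m" using t by simp
  hence "axis_L t * t powr p \<le> real n ^ n * t ^ m * t powr p" by (intro mult_right_mono) auto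
  also have "\<dots> = real n ^ n * t powr (real m + p)" using t by (simp add: powr_add powr_realpow)
  also have "\<dots> \<le> real n ^ n * 1"
  proof (intro mult_left_mono)
    have "real m + p \<ge> 0" by (simp add: m_def) linarith
    hence "t powr (real m + p) \<le> 1 powr (real m + p)" using t by (intro powr_mono2) auto
    thus "t powr (real m + p) \<le> 1" by simp
  qed auto
  finally show "axis_L t * t powr p \<le> real n ^ n" by simp
qed

section \<open>Integrability on (0,1) and positivity of the coefficients\<close>

lemma set_borel_measurable_lborel_continuous:
  fixes f :: "real \<Rightarrow> 'a::real_normed_vector"
  assumes "open A" "continuous_on A f"
  shows "set_borel_measurable lborel A f"
  unfolding set_borel_measurable_def using borel_measurable_continuous_on_indicator[OF _ assms(2)] assms(1) by simp

lemma axis_L_powr_integrable: "set_integrable lborel {0<..<1} (\<lambda>t. axis_L t * t powr p)"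
proof -
  obtain K where K: "\<And>t. 0 < t \<Longrightarrow> t < 1 \<Longrightarrow> axis_L t * t powr p \<le> K" using axis_L_rapid_decay[of p] by blast
  show ?thesis
  proof (rule set_integrable_bound)
    show "set_integrable lborel {0<..<1::real} (\<lambda>_. \<bar>K\<bar>)" unfolding set_integrable_def by simp
    show "set_borel_measurable lborel {0<..<1} (\<lambda>t. axis_L t * t powr p)"
      by (rule set_borel_measurable_lborel_continuous)
         (auto intro!: continuous_intros continuous_on_subset[OF continuous_on_axis_L])
    show "AE t in lborel. t \<in> {0<..<1} \<longrightarrow> norm (axis_L t * t powr p) \<le> norm \<bar>K\<bar>"
      using axis_L_pos
      by (intro always_eventually) (auto simp: abs_mult abs_of_pos intro: order_trans[OF K abs_ge_self])
  qed
qed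

lemma set_integrable_axis_L_bound:
  fixes f :: "real \<Rightarrow> 'a::{banach, second_countable_topology}"
  assumes cont: "continuous_on {0<..<1} f"
    and bnd: "\<And>t. 0 < t \<Longrightarrow> t < 1 \<Longrightarrow> norm (f t) \<le> axis_L t * t powr p"
  shows "set_integrable lborel {0<..<1} f"
proof (rule set_integrable_bound[OF axis_L_powr_integrable[of p]])
  show "set_borel_measurable lborel {0<..<1} f"
    by (rule set_borel_measurable_lborel_continuous[OF open_greaterThanLessThan cont])
  show "AE t in lborel. t \<in> {0<..<1} \<longrightarrow> norm (f t) \<le> norm (axis_L t * t powr p)"
  proof (intro always_eventually allI impI)
    fix t :: real assume "t \<in> {0<..<1}"
    hence "norm (f t) \<le> axis_L t * t powr p" by (intro bnd) auto
    thus "norm (f t) \<le> norm (axis_L t * t powr p)" by simp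
  qed
qed

definition chi_integrand :: "nat \<Rightarrow> real \<Rightarrow> real" where
  "chi_integrand s t = axis_L t * t ^ 5 * (ln t ^ (2 * s) / fact (2 * s))"

lemma chi_integrand_integrable: "set_integrable lborel {0<..<1} (chi_integrand s)"
proof (rule set_integrable_axis_L_bound[where p = "- 1"])
  show "continuous_on {0<..<1} (chi_integrand s)"
    unfolding chi_integrand_def[abs_def] by (auto intro!: continuous_intros continuous_on_subset[OF continuous_on_axis_L])
  fix t :: real assume t: "0 < t" "t < 1"
  have l: "ln t < 0" using t by simp
  have ev: "ln t ^ (2 * s) = (- ln t) ^ (2 * s)" by simp
  \<comment> \<open>A single term of the exponential series of -ln t > 0 is at most its sum, which
    is 1/t.\<close>
  have "ln t ^ (2 * s) / fact (2 * s) \<le> exp (- ln t)"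
  proof -
    have "(\<Sum>n\<in>{2 * s}. (- ln t) ^ n /\<^sub>R fact n) \<le> exp (- ln t)"
      unfolding exp_def using summable_exp_generic[of "- ln t"] l
      by (intro sum_le_suminf) (auto intro!: mult_nonneg_nonneg)
    thus ?thesis unfolding ev by (simp add: divide_inverse mult.commute)
  qed
  also have "exp (- ln t) = t powr (- 1)" using t by (simp add: powr_def)
  finally have 1: "ln t ^ (2 * s) / fact (2 * s) \<le> t powr (- 1)" .
  have "axis_L t * t ^ 5 * (ln t ^ (2 * s) / fact (2 * s)) \<le> axis_L t * 1 * t powr (- 1)"
    using t axis_L_pos[of t] 1 by (intro mult_mono power_le_one) (auto intro!: mult_nonneg_nonneg divide_nonneg_nonneg zero_le_even_power)
  thus "norm (chi_integrand s t) \<le> axis_L t * t powr (- 1)"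
    unfolding chi_integrand_def using t axis_L_pos[of t]
    by (simp add: abs_mult less_imp_le power_even_abs)
qed

lemma chi_eq: "chi s = of_real (2 * (LINT t:{0<..<1}|lborel. chi_integrand s t))"
proof -
  have "(LBINT \<omega>=0..1. ramanujan_L (\<i> * of_real \<omega>) * of_real (\<omega> ^ 5) * of_real (ln \<omega> ^ (2 * s) / fact (2 * s)))
      = (LINT \<omega>:{0<..<1}|lborel. ramanujan_L (\<i> * of_real \<omega>) * of_real (\<omega> ^ 5) * of_real (ln \<omega> ^ (2 * s) / fact (2 * s)))"
    by (simp add: interval_lebesgue_integral_def zero_ereal_def one_ereal_def)
  also have "\<dots> = (LINT \<omega>:{0<..<1}|lborel. complex_of_real (chi_integrand s \<omega>))"
    by (intro set_lebesgue_integral_cong) (auto simp: chi_integrand_def ramanujan_L_axis)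
  also have "\<dots> = of_real (LINT \<omega>:{0<..<1}|lborel. chi_integrand s \<omega>)"
    by (rule set_integral_complex_of_real)
  finally show ?thesis by (simp add: chi_def)
qed

lemma chi_integral_pos: "(LINT t:{0<..<1}|lborel. chi_integrand s t) > 0"
proof -
  define f where "f t = indicator {0<..<1} t *\<^sub>R chi_integrand s t" for t :: real
  have int: "integrable lborel f"
    using chi_integrand_integrable[of s] by (simp add: set_integrable_def f_def[abs_def])
  have pos: "chi_integrand s t > 0" if "0 < t" "t < 1" for t
  proof -
    have "ln t \<noteq> 0" using that by simp
    hence "ln t ^ (2 * s) > 0" by (simp add: power_mult)
    thus ?thesis using that axis_L_pos[of t] by (simp add: chi_integrand_def)
  qed
  have nn: "f t \<ge> 0" for t using pos[of t] by (simp add: f_def indicator_def less_imp_le)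
  have "integral\<^sup>L lborel f \<noteq> 0"
  proof
    assume "integral\<^sup>L lborel f = 0"
    hence "AE t in lborel. f t = 0" using integral_nonneg_eq_0_iff_AE[OF int] nn by simp
    hence "AE t in lborel. t \<notin> {0<..<1::real}"
      by eventually_elim (use pos in \<open>force simp: f_def\<close>)
    hence "{0<..<1::real} \<in> null_sets lborel" by (subst AE_iff_null_sets) auto
    thus False by (auto simp: null_sets_def)
  qed
  moreover have "integral\<^sup>L lborel f \<ge> 0" using nn by simp
  ultimately show ?thesis by (simp add: set_lebesgue_integral_def f_def[abs_def])
qed

lemma chi_real_pos: "chi s \<in> \<real>" "Re (chi s) > 0"
  using chi_integral_pos[of s] by (simp_all add: chi_eq)

lemma cosh_even_series:
  fixes z :: "'a::{banach, real_normed_field}"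
  shows "(\<lambda>s. z ^ (2 * s) / fact (2 * s)) sums cosh z"
proof -
  have "(\<lambda>s. (if even (2 * s) then z ^ (2 * s) /\<^sub>R fact (2 * s) else 0)) sums cosh z"
    using cosh_converges[of z] by (subst sums_mono_reindex[where g = "\<lambda>s. 2 * s"])
      (auto simp: strict_mono_def elim!: evenE)
  thus ?thesis by (simp add: scaleR_conv_of_real field_simps)
qed

text \<open>Restricting the Mellin integral to (0,1) makes it converge for every x. The part over
  (1, infinity) becomes the same integral at 12 - x by inversion, so the sum of the two values is
  the completed zeta function.\<close>

definition half_mellin :: "complex \<Rightarrow> complex" where
  "half_mellin x = (LINT t:{0<..<1}|lborel. of_real (axis_L t) * of_real t powr (x - 1))"

lemma half_mellin_integrable:
  fixes x :: complex
  shows "set_integrable lborel {0<..<1} (\<lambda>t. of_real (axis_L t) * of_real t powr (x - 1))"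
proof (rule set_integrable_axis_L_bound[where p = "Re x - 1"])
  show "continuous_on {0<..<1} (\<lambda>t. of_real (axis_L t) * of_real t powr (x - 1))"
    by (auto intro!: continuous_intros continuous_on_subset[OF continuous_on_axis_L])
  fix t :: real assume t: "0 < t" "t < 1"
  thus "norm (of_real (axis_L t) * of_real t powr (x - 1)) \<le> axis_L t * t powr (Re x - 1)"
    using axis_L_pos[of t] by (simp add: norm_mult norm_powr_real_powr)
qed

text \<open>Rests on 2 t^5 cosh((x - 6) ln t) = t^(x - 1) + t^(11 - x), with cosh expanded and
  integrated termwise by dominated convergence.\<close>

lemma chi_series_sums: "(\<lambda>s. chi s * (x - 6) ^ (2 * s)) sums (half_mellin x + half_mellin (12 - x))"
proof -
  define y where "y = x - 6"
  define c where "c = norm y"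
  define g where "g s t = of_real (2 * chi_integrand s t) * y ^ (2 * s)" for s t
  define h where "h t = of_real (2 * axis_L t * t ^ 5) * cosh (y * of_real (ln t))" for t
  have gint: "set_integrable lborel {0<..<1} (g s)" for s
  proof -
    have "set_integrable lborel {0<..<1} (\<lambda>t. complex_of_real (2 * chi_integrand s t))"
    proof -
      have "set_integrable lborel {0<..<1} (\<lambda>t. 2 * chi_integrand s t)"
        using chi_integrand_integrable[of s] by (intro set_integrable_mult_right)
      hence "integrable lborel (\<lambda>t. complex_of_real (indicator {0<..<1} t *\<^sub>R (2 * chi_integrand s t)))"
        unfolding set_integrable_def by (rule integrable_of_real)
      thus ?thesis unfolding set_integrable_def by (simp add: scaleR_conv_of_real)
    qed
    thus ?thesis unfolding g_def[abs_def] by (intro set_integrable_mult_left)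
  qed
  have g_alt: "g s t = of_real (2 * axis_L t * t ^ 5) * ((y * of_real (ln t)) ^ (2 * s) / fact (2 * s))" for s t
    by (simp add: g_def chi_integrand_def power_mult_distrib)
  have "(\<lambda>N. LINT t|lborel. (\<Sum>s<N. indicator {0<..<1} t *\<^sub>R g s t)) \<longlonglongrightarrow> (LINT t|lborel. indicator {0<..<1} t *\<^sub>R h t)"
  proof (rule integral_dominated_convergence)
    show "integrable lborel (\<lambda>t. 2 * (indicator {0<..<1} t *\<^sub>R (axis_L t * t powr (- c))))"
      using axis_L_powr_integrable[of "- c"] unfolding set_integrable_def by (rule integrable_mult_right)
    have "set_borel_measurable lborel {0<..<1} h"
      unfolding h_def[abs_def]
      by (rule set_borel_measurable_lborel_continuous)
         (auto intro!: continuous_intros continuous_on_subset[OF continuous_on_axis_L])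
    thus "(\<lambda>t. indicator {0<..<1} t *\<^sub>R h t) \<in> borel_measurable lborel"
      by (simp add: set_borel_measurable_def)
    show "(\<lambda>t. \<Sum>s<N. indicator {0<..<1} t *\<^sub>R g s t) \<in> borel_measurable lborel" for N
      using gint unfolding set_integrable_def by (intro borel_measurable_sum borel_measurable_integrable)
    have "(\<lambda>s. g s t) sums h t" for t
      unfolding g_alt h_def by (intro sums_mult cosh_even_series)
    hence "(\<lambda>N. \<Sum>s<N. indicator {0<..<1} t *\<^sub>R g s t) \<longlonglongrightarrow> indicator {0<..<1} t *\<^sub>R h t" for t
      unfolding scaleR_right.sum[symmetric] sums_def by (intro tendsto_scaleR tendsto_const)
    thus "AE t in lborel. (\<lambda>N. \<Sum>s<N. indicator {0<..<1} t *\<^sub>R g s t) \<longlonglongrightarrow> indicator {0<..<1} t *\<^sub>R h t"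
      by (intro always_eventually) auto
    show "AE t in lborel. norm (\<Sum>s<N. indicator {0<..<1} t *\<^sub>R g s t) \<le> 2 * (indicator {0<..<1} t *\<^sub>R (axis_L t * t powr (- c)))" for N
    proof (intro always_eventually allI)
      fix t :: real
      show "norm (\<Sum>s<N. indicator {0<..<1} t *\<^sub>R g s t) \<le> 2 * (indicator {0<..<1} t *\<^sub>R (axis_L t * t powr (- c)))"
      proof (cases "t \<in> {0<..<1}")
        case True
        hence t: "0 < t" "t < 1" by auto
        \<comment> \<open>All partial sums of the even series lie below cosh u <= exp u = t^(-c)
          with c = |x - 6|; the rapid decay of \<open>axis_L\<close> makes this integrable for every
          c.\<close>
        define u where "u = c * (- ln t)"
        have u: "u \<ge> 0" using t by (simp add: u_def c_def mult_nonneg_nonpos)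
        define z where "z = y * complex_of_real (ln t)"
        have nz: "norm z = u" using t by (simp add: u_def c_def z_def norm_mult)
        have ng: "norm (g s t) = 2 * axis_L t * t ^ 5 * (u ^ (2 * s) / fact (2 * s))" for s
        proof -
          have "norm (g s t) = norm (complex_of_real (2 * axis_L t * t ^ 5)) * norm (z ^ (2 * s) / fact (2 * s))"
            unfolding g_alt z_def by (rule norm_mult)
          also have "norm (complex_of_real (2 * axis_L t * t ^ 5)) = 2 * axis_L t * t ^ 5"
            unfolding norm_of_real using t axis_L_pos[of t] by simp
          also have "norm (z ^ (2 * s) / fact (2 * s)) = u ^ (2 * s) / fact (2 * s)"
            by (simp add: norm_divide norm_power nz)
          finally show ?thesis .
        qed
        have "norm (\<Sum>s<N. g s t) \<le> (\<Sum>s<N. norm (g s t))" by (rule norm_sum)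
        also have "\<dots> = 2 * axis_L t * t ^ 5 * (\<Sum>s<N. u ^ (2 * s) / fact (2 * s))"
          unfolding ng sum_distrib_left ..
        also have "\<dots> \<le> 2 * axis_L t * t ^ 5 * cosh u"
        proof -
          have "(\<Sum>s<N. u ^ (2 * s) / fact (2 * s)) \<le> (\<Sum>s. u ^ (2 * s) / fact (2 * s))"
            by (rule sum_le_suminf[OF sums_summable[OF cosh_even_series]]) (use u in simp_all)
          also have "\<dots> = cosh u" by (rule sums_unique[OF cosh_even_series, symmetric])
          finally show ?thesis using t axis_L_pos[of t] by (intro mult_left_mono) auto
        qed
        also have "cosh u \<le> exp u" using u by (simp add: cosh_field_def)
        also have "exp u = t powr (- c)" using t by (simp add: u_def powr_def)
        also have "2 * axis_L t * t ^ 5 * t powr (- c) \<le> 2 * axis_L t * 1 * t powr (- c)"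
          using t axis_L_pos[of t] by (intro mult_right_mono mult_left_mono power_le_one) auto
        finally show ?thesis using t axis_L_pos[of t] by (simp add: mult_left_mono)
      qed simp
    qed
  qed
  also have "(\<lambda>N. LINT t|lborel. (\<Sum>s<N. indicator {0<..<1} t *\<^sub>R g s t)) = (\<lambda>N. \<Sum>s<N. chi s * y ^ (2 * s))"
  proof
    fix N
    have "(LINT t|lborel. (\<Sum>s<N. indicator {0<..<1} t *\<^sub>R g s t)) = (\<Sum>s<N. LINT t:{0<..<1}|lborel. g s t)"
      using gint unfolding set_integrable_def set_lebesgue_integral_def by (intro Bochner_Integration.integral_sum)
    also have "\<dots> = (\<Sum>s<N. chi s * y ^ (2 * s))"
      unfolding g_def set_integral_mult_left set_integral_complex_of_real chi_eq set_integral_mult_right ..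
    finally show "(LINT t|lborel. (\<Sum>s<N. indicator {0<..<1} t *\<^sub>R g s t)) = (\<Sum>s<N. chi s * y ^ (2 * s))" .
  qed
  also have "(LINT t|lborel. indicator {0<..<1} t *\<^sub>R h t) = (LINT t:{0<..<1}|lborel.
      of_real (axis_L t) * of_real t powr (x - 1) + of_real (axis_L t) * of_real t powr (12 - x - 1))"
    unfolding set_lebesgue_integral_def[symmetric]
  proof (intro set_lebesgue_integral_cong allI impI)
    fix t :: real assume "t \<in> {0<..<1}"
    hence t: "0 < t" by auto
    define l where "l = complex_of_real (ln t)"
    have pw: "of_real t powr z = exp (z * l)" for z :: complex
      using t by (simp add: powr_def l_def Ln_of_real)
    have t5: "of_real (t ^ 5) = exp (5 * l)" 
      using t exp_of_nat_mult[of 5 l] by (simp add: l_def exp_of_real)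
    have "2 * of_real (t ^ 5) * cosh (y * l) = of_real t powr (x - 1) + of_real t powr (12 - x - 1)"
      unfolding pw t5 cosh_field_def y_def
      by (simp add: algebra_simps flip: exp_add)
    hence "of_real (axis_L t) * (2 * of_real (t ^ 5) * cosh (y * l)) =
       of_real (axis_L t) * (of_real t powr (x - 1) + of_real t powr (12 - x - 1))" by simp
    thus "h t = of_real (axis_L t) * of_real t powr (x - 1) + of_real (axis_L t) * of_real t powr (12 - x - 1)"
      by (simp add: h_def l_def algebra_simps)
  qed auto
  also have "\<dots> = half_mellin x + half_mellin (12 - x)"
    unfolding half_mellin_def by (intro set_integral_add half_mellin_integrable)
  finally show ?thesis unfolding sums_def y_def .
qed

section \<open>The Mellin transform and the analytic continuations\<close>

lemma mellin_exp:
  fixes x :: complex and a :: real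
  assumes a: "a > 0" and x: "Re x > 0"
  shows "set_integrable lborel {0<..} (\<lambda>t. of_real (exp (- a * t)) * of_real t powr (x - 1))"
    and "(LINT t:{0<..}|lborel. of_real (exp (- a * t)) * of_real t powr (x - 1)) = Gamma x * of_real a powr (- x)"
proof -
  define f where "f b t = indicator {0<..} t *\<^sub>R (of_real (exp (- b * t)) * complex_of_real t powr (x - 1))" for b t :: real
  have f_alt: "f b t = indicator {0<..} t *\<^sub>R (complex_of_real t powr (x - 1) / of_real (exp (b * t)))" for b t
    by (simp add: f_def exp_minus divide_inverse)
  have meas: "f b \<in> borel_measurable lborel" for b
  proof -
    have "set_borel_measurable lborel {0<..} (\<lambda>t. of_real (exp (- b * t)) * complex_of_real t powr (x - 1))"
      by (rule set_borel_measurable_lborel_continuous) (auto intro!: continuous_intros)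
    thus ?thesis by (simp only: set_borel_measurable_def f_def[abs_def])
  qed
  \<comment> \<open>Absolute integrability of the Gamma integrand refers to the completed measure;
    Borel measurability brings it down to \<open>lborel\<close>.\<close>
  have int: "integrable lborel (f b)" if "b > 0" for b
    using absolutely_integrable_Gamma_integral[OF x that] integrable_completion[OF meas[of b]]
    by (simp add: set_integrable_def f_alt[abs_def])
  have "(LINT t:{0<..}|lborel. complex_of_real t powr (x - 1) / of_real (exp t)) = Gamma x"
    using set_borel_integral_eq_integral(2)[of "{0<..}" "\<lambda>t. complex_of_real t powr (x - 1) / of_real (exp t)"]
      int[of 1] Gamma_integral_complex'[OF x]
    by (simp add: set_integrable_def f_alt[abs_def] integral_unique)
  hence "integral\<^sup>L lborel (f 1) = Gamma x"
    by (simp add: set_lebesgue_integral_def f_alt[abs_def])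
  \<comment> \<open>Rescaling t to a t; the Jacobian a and the factor a^(x - 1) combine to
    a^x.\<close>
  also have "integral\<^sup>L lborel (f 1) = \<bar>a\<bar> *\<^sub>R (LINT t|lborel. f 1 (0 + a * t))"
    using a by (intro lborel_integral_real_affine) auto
  also have "(\<lambda>t. f 1 (0 + a * t)) = (\<lambda>t. of_real a powr (x - 1) * f a t)"
  proof
    fix t
    have "complex_of_real (a * t) powr (x - 1) = of_real a powr (x - 1) * of_real t powr (x - 1)"
      using a by (simp add: powr_times_real_left)
    thus "f 1 (0 + a * t) = of_real a powr (x - 1) * f a t"
      using a by (simp add: f_def indicator_def zero_less_mult_iff scaleR_conv_of_real)
  qed
  also have "(LINT t|lborel. of_real a powr (x - 1) * f a t) = of_real a powr (x - 1) * integral\<^sup>L lborel (f a)"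
    by simp
  also have "\<bar>a\<bar> *\<^sub>R (of_real a powr (x - 1) * integral\<^sup>L lborel (f a)) = of_real a powr x * integral\<^sup>L lborel (f a)"
    using a by (simp add: scaleR_conv_of_real powr_diff)
  finally have "integral\<^sup>L lborel (f a) = Gamma x * of_real a powr (- x)"
    using a by (simp add: powr_minus field_simps)
  thus "(LINT t:{0<..}|lborel. of_real (exp (- a * t)) * of_real t powr (x - 1)) = Gamma x * of_real a powr (- x)"
    by (simp add: set_lebesgue_integral_def f_def[abs_def])
  show "set_integrable lborel {0<..} (\<lambda>t. of_real (exp (- a * t)) * of_real t powr (x - 1))"
    using int[OF a] by (simp add: set_integrable_def f_def[abs_def])
qed

text \<open>Evaluates the integrals of norms that control termwise integration in
  \<open>mellin_axis_L\<close>.\<close>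

lemma mellin_exp_real:
  fixes a \<sigma> :: real
  assumes a: "a > 0" and s: "\<sigma> > 0"
  shows "(LINT t:{0<..}|lborel. exp (- a * t) * t powr (\<sigma> - 1)) = Gamma \<sigma> * a powr (- \<sigma>)"
proof -
  have "complex_of_real (LINT t:{0<..}|lborel. exp (- a * t) * t powr (\<sigma> - 1)) =
      (LINT t:{0<..}|lborel. complex_of_real (exp (- a * t) * t powr (\<sigma> - 1)))"
    by (rule set_integral_complex_of_real[symmetric])
  also have "\<dots> = (LINT t:{0<..}|lborel. of_real (exp (- a * t)) * of_real t powr (of_real \<sigma> - 1))"
  proof (intro set_lebesgue_integral_cong allI impI)
    fix t :: real assume "t \<in> {0<..}"
    thus "complex_of_real (exp (- a * t) * t powr (\<sigma> - 1)) = of_real (exp (- a * t)) * of_real t powr (of_real \<sigma> - 1)"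
      using powr_of_real[of t "\<sigma> - 1"] by simp
  qed auto
  also have "\<dots> = Gamma (of_real \<sigma>) * of_real a powr (- of_real \<sigma>)"
    using a s by (intro mellin_exp(2)) auto
  also have "\<dots> = of_real (Gamma \<sigma> * a powr (- \<sigma>))"
    using a by (simp add: Gamma_complex_of_real powr_of_real flip: of_real_minus)
  finally show ?thesis by (simp only: of_real_eq_iff)
qed

lemma axis_L_sums:
  assumes t: "t > 0"
  shows "(\<lambda>n. ramanujan_tau (Suc n) * of_real (exp (- (2 * pi * real (Suc n)) * t))) sums of_real (axis_L t)"
    and "summable (\<lambda>n. norm (ramanujan_tau (Suc n) * of_real (exp (- (2 * pi * real (Suc n)) * t))))"
proof -
  define r where "r = exp (- (2 * pi) * t)"
  have r: "0 < r" "r < 1" using t by (auto simp: r_def)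
  have rn: "exp (- (2 * pi * real (Suc n)) * t) = r ^ Suc n" for n
    unfolding r_def exp_of_nat_mult[symmetric] by (simp add: algebra_simps)
  have nome: "nome (\<i> * of_real t) = of_real r"
  proof -
    have "2 * of_real pi * \<i> * (\<i> * of_real t) = complex_of_real (- (2 * pi) * t)" by (simp add: complex_eq_iff)
    thus ?thesis unfolding nome_def r_def by (simp only: exp_of_real)
  qed
  have "disc_L (of_real r) = of_real (axis_L t)"
    using ramanujan_L_eq_disc_L[of "\<i> * of_real t"] ramanujan_L_axis[OF t] t by (simp add: nome)
  hence "(\<lambda>m. ramanujan_tau m * of_real r ^ m) sums of_real (axis_L t)"
    using ramanujan_tau_sums[of "of_real r"] r by simp
  hence "(\<lambda>m. ramanujan_tau (Suc m) * of_real r ^ Suc m) sums of_real (axis_L t)"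
    by (subst sums_Suc_iff) (simp add: ramanujan_tau_0)
  thus "(\<lambda>n. ramanujan_tau (Suc n) * of_real (exp (- (2 * pi * real (Suc n)) * t))) sums of_real (axis_L t)"
    unfolding rn by simp
  \<comment> \<open>Absolute convergence at r follows from convergence at a strictly larger radius
    inside the unit disc.\<close>
  define r' where "r' = (r + 1) / 2"
  have r': "r < r'" "0 < r'" "r' < 1" using r by (auto simp: r'_def)
  have "summable (\<lambda>m. ramanujan_tau m * of_real r' ^ m)"
    using ramanujan_tau_sums[of "of_real r'"] r' by (auto simp: sums_iff)
  hence "summable (\<lambda>m. norm (ramanujan_tau m * of_real r ^ m))"
    by (rule powser_insidea) (use r r' in auto)
  hence "summable (\<lambda>m. norm (ramanujan_tau (Suc m) * of_real r ^ Suc m))"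
    by (subst summable_Suc_iff)
  thus "summable (\<lambda>n. norm (ramanujan_tau (Suc n) * of_real (exp (- (2 * pi * real (Suc n)) * t))))"
    unfolding rn by simp
qed

text \<open>Termwise integration of the q-expansion. The integrals of the norms sum to
  Gamma(\<sigma>) (2 pi)^(-\<sigma>) times the series of |tau(n)| n^(-\<sigma>), which the
  coefficient bound n^(13/2) controls for \<sigma> > 15/2.\<close>

lemma mellin_axis_L:
  fixes x :: complex
  assumes x: "Re x > 15 / 2"
  shows "set_integrable lborel {0<..} (\<lambda>t. of_real (axis_L t) * of_real t powr (x - 1))"
    and "(LINT t:{0<..}|lborel. of_real (axis_L t) * of_real t powr (x - 1)) =
           (2 * of_real pi) powr (- x) * Gamma x * ramanujan_zeta_series x"
proof -
  define \<sigma> where "\<sigma> = Re x"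
  have s: "\<sigma> > 15 / 2" using x by (simp add: \<sigma>_def)
  define a where "a n = 2 * pi * real (Suc n)" for n
  have a: "a n > 0" for n by (simp add: a_def)
  define e where "e n t = of_real (exp (- a n * t)) * complex_of_real t powr (x - 1)" for n t
  define f where "f n t = indicator {0<..} t *\<^sub>R (ramanujan_tau (Suc n) * e n t)" for n and t :: real
  have int_e: "set_integrable lborel {0<..} (e n)" for n
    unfolding e_def[abs_def] using s a by (intro mellin_exp) (auto simp: \<sigma>_def)
  have int_f: "integrable lborel (f n)" for n
  proof -
    have "set_integrable lborel {0<..} (\<lambda>t. ramanujan_tau (Suc n) * e n t)"
      by (intro set_integrable_mult_right int_e)
    thus ?thesis by (simp only: set_integrable_def f_def[abs_def])
  qed
  have integral_f: "integral\<^sup>L lborel (f n) =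
      (2 * of_real pi) powr (- x) * Gamma x * (ramanujan_tau (Suc n) * of_nat (Suc n) powr (- x))" for n
  proof -
    have "integral\<^sup>L lborel (f n) = (LINT t:{0<..}|lborel. ramanujan_tau (Suc n) * e n t)"
      by (simp only: set_lebesgue_integral_def f_def[abs_def])
    also have "\<dots> = ramanujan_tau (Suc n) * (LINT t:{0<..}|lborel. e n t)"
      by (rule set_integral_mult_right)
    also have "(LINT t:{0<..}|lborel. e n t) = Gamma x * of_real (a n) powr (- x)"
      unfolding e_def using s a by (intro mellin_exp) (auto simp: \<sigma>_def)
    also have "complex_of_real (a n) = (2 * of_real pi) * of_nat (Suc n)" by (simp add: a_def)
    also have "\<dots> powr (- x) = (2 * of_real pi) powr (- x) * of_nat (Suc n) powr (- x)"
      by (rule powr_times_real_left) (auto intro!: Reals_mult)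
    finally show ?thesis by (simp only: mult_ac)
  qed
  have norm_f: "norm (f n t) = indicator {0<..} t *\<^sub>R (norm (ramanujan_tau (Suc n)) * (exp (- a n * t) * t powr (\<sigma> - 1)))" for n t
    by (simp add: f_def e_def norm_mult indicator_def norm_powr_real_powr \<sigma>_def)
  have integral_norm_f: "(LINT t|lborel. norm (f n t)) = norm (ramanujan_tau (Suc n)) * (Gamma \<sigma> * a n powr (- \<sigma>))" for n
  proof -
    have "(LINT t|lborel. norm (f n t)) = (LINT t:{0<..}|lborel. norm (ramanujan_tau (Suc n)) * (exp (- a n * t) * t powr (\<sigma> - 1)))"
      by (simp only: norm_f set_lebesgue_integral_def)
    also have "\<dots> = norm (ramanujan_tau (Suc n)) * (LINT t:{0<..}|lborel. exp (- a n * t) * t powr (\<sigma> - 1))"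
      by (rule set_integral_mult_right)
    also have "(LINT t:{0<..}|lborel. exp (- a n * t) * t powr (\<sigma> - 1)) = Gamma \<sigma> * a n powr (- \<sigma>)"
      using a s by (intro mellin_exp_real) auto
    finally show ?thesis .
  qed
  have summ: "summable (\<lambda>n. LINT t|lborel. norm (f n t))"
  proof -
    obtain C where C: "C > 0" "\<And>n. n > 0 \<Longrightarrow> norm (ramanujan_tau n) \<le> C * real n powr (13 / 2)"
      using ramanujan_tau_bound by metis
    have G: "Gamma \<sigma> > 0" using s by (intro Gamma_real_pos) auto
    have "summable (\<lambda>n. real n powr (13 / 2 - \<sigma>))" using s by (subst summable_real_powr_iff) simp
    hence "summable (\<lambda>n. real (Suc n) powr (13 / 2 - \<sigma>))" by (subst summable_Suc_iff)
    hence "summable (\<lambda>n. (C * Gamma \<sigma> * (2 * pi) powr (- \<sigma>)) * real (Suc n) powr (13 / 2 - \<sigma>))"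
      by (rule summable_mult)
    thus ?thesis
    proof (rule summable_comparison_test'[where N = 0])
      fix n :: nat
      have pa: "a n powr (- \<sigma>) = (2 * pi) powr (- \<sigma>) * real (Suc n) powr (- \<sigma>)"
        unfolding a_def by (rule powr_mult)
      have "norm (LINT t|lborel. norm (f n t)) = norm (ramanujan_tau (Suc n)) * (Gamma \<sigma> * a n powr (- \<sigma>))"
        unfolding integral_norm_f using G by simp
      also have "\<dots> \<le> C * real (Suc n) powr (13 / 2) * (Gamma \<sigma> * ((2 * pi) powr (- \<sigma>) * real (Suc n) powr (- \<sigma>)))"
        unfolding pa using C G by (intro mult_right_mono C(2)) auto
      also have "C * real (Suc n) powr (13 / 2) * (Gamma \<sigma> * ((2 * pi) powr (- \<sigma>) * real (Suc n) powr (- \<sigma>))) =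
          (C * Gamma \<sigma> * (2 * pi) powr (- \<sigma>)) * (real (Suc n) powr (13 / 2) * real (Suc n) powr (- \<sigma>))"
        by (simp only: mult_ac)
      also have "real (Suc n) powr (13 / 2) * real (Suc n) powr (- \<sigma>) = real (Suc n) powr (13 / 2 - \<sigma>)"
        by (subst powr_add[symmetric]) simp
      finally show "norm (LINT t|lborel. norm (f n t)) \<le>
          (C * Gamma \<sigma> * (2 * pi) powr (- \<sigma>)) * real (Suc n) powr (13 / 2 - \<sigma>)" .
    qed
  qed
  have ae: "AE t in lborel. summable (\<lambda>n. norm (f n t))"
  proof (intro always_eventually allI)
    fix t :: real
    show "summable (\<lambda>n. norm (f n t))"
    proof (cases "t > 0")
      case True
      have "f n t = (ramanujan_tau (Suc n) * of_real (exp (- a n * t))) * of_real t powr (x - 1)" for n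
        using True by (simp add: f_def e_def)
      thus ?thesis unfolding norm_mult[of "_ * _"]
        using summable_mult2[OF axis_L_sums(2)[OF True]] by (simp only: a_def norm_mult[of "_ * _" "_ powr _"])
    qed (simp add: f_def)
  qed
  have suminf: "(\<Sum>n. f n t) = indicator {0<..} t *\<^sub>R (of_real (axis_L t) * of_real t powr (x - 1))" for t
  proof (cases "t > 0")
    case True
    have "f n t = (ramanujan_tau (Suc n) * of_real (exp (- a n * t))) * of_real t powr (x - 1)" for n
      using True by (simp add: f_def e_def)
    moreover have "(\<lambda>n. (ramanujan_tau (Suc n) * of_real (exp (- a n * t))) * of_real t powr (x - 1)) sums
        (of_real (axis_L t) * of_real t powr (x - 1))"
      unfolding a_def by (intro sums_mult2 axis_L_sums True)
    ultimately show ?thesis using True by (simp add: sums_iff)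
  qed (simp add: f_def)
  have "integrable lborel (\<lambda>t. \<Sum>n. f n t)" by (rule integrable_suminf[OF int_f ae summ])
  thus "set_integrable lborel {0<..} (\<lambda>t. of_real (axis_L t) * of_real t powr (x - 1))"
    by (simp only: suminf set_integrable_def)
  have "(\<lambda>n. integral\<^sup>L lborel (f n)) sums (LINT t|lborel. (\<Sum>n. f n t))"
    by (rule sums_integral[OF int_f ae summ])
  hence sums: "(\<lambda>n. (2 * of_real pi) powr (- x) * Gamma x * (ramanujan_tau (Suc n) * of_nat (Suc n) powr (- x))) sums
      (LINT t:{0<..}|lborel. of_real (axis_L t) * of_real t powr (x - 1))"
    by (simp only: suminf integral_f set_lebesgue_integral_def)
  define c where "c = (2 * of_real pi) powr (- x) * Gamma x"
  have c: "c \<noteq> 0"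
    using s by (auto simp: c_def Gamma_eq_zero_iff \<sigma>_def elim!: nonpos_Ints_cases)
  from sums_divide[OF sums, of c] have "(\<lambda>n. ramanujan_tau (Suc n) * of_nat (Suc n) powr (- x)) sums
      ((LINT t:{0<..}|lborel. of_real (axis_L t) * of_real t powr (x - 1)) / c)"
    unfolding c_def[symmetric] using c by simp
  hence "(LINT t:{0<..}|lborel. of_real (axis_L t) * of_real t powr (x - 1)) / c = ramanujan_zeta_series x"
    unfolding ramanujan_zeta_series_def by (simp add: sums_iff)
  thus "(LINT t:{0<..}|lborel. of_real (axis_L t) * of_real t powr (x - 1)) =
           (2 * of_real pi) powr (- x) * Gamma x * ramanujan_zeta_series x"
    using c unfolding c_def[symmetric] by (simp add: field_simps)
qed

text \<open>Under t = 1/u the weight 12 and the Jacobian u^(-2) produce the exponent 12 - 2 - (x -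
  1) = 12 - x - 1. The reflection t -> -t comes first because the substitution rule asks for an
  increasing map, and u -> -1/u increases from (0,1) onto (-infinity, -1).\<close>

lemma mellin_upper_half:
  fixes x :: complex
  assumes int: "set_integrable lborel {0<..} (\<lambda>t. of_real (axis_L t) * of_real t powr (x - 1))"
  shows "(LINT t:{1<..}|lborel. of_real (axis_L t) * of_real t powr (x - 1)) = half_mellin (12 - x)"
proof -
  define G where "G t = of_real (axis_L t) * complex_of_real t powr (x - 1)" for t
  define H where "H t = of_real (axis_L t) * complex_of_real t powr (12 - x - 1)" for t
  have intG: "set_integrable lborel {1<..} G"
    by (rule set_integrable_subset[OF int[folded G_def]]) auto
  have ii: "interval_lebesgue_integrable lborel 1 \<infinity> G"
    using intG by (simp add: interval_lebesgue_integrable_def one_ereal_def)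
  have ii': "interval_lebesgue_integrable lborel (- \<infinity>) (- 1) (\<lambda>t. G (- t))"
    by (subst interval_integrable_mirror) (use ii in simp)
  have sub: "(1 / u\<^sup>2) *\<^sub>R G (- (- 1 / u)) = H u" if u: "u > 0" for u :: real
  proof -
    define l where "l = complex_of_real (ln u)"
    have p: "of_real u powr z = exp (z * l)" for z :: complex
      using u by (simp add: powr_def l_def Ln_of_real)
    have q: "of_real (1 / u) powr z = exp (- (z * l))" for z :: complex
      using u by (simp add: powr_def l_def Ln_of_real ln_div flip: of_real_divide)
    have "complex_of_real (1 / u\<^sup>2 * u ^ 12) = of_real (u ^ 10)"
      using u by (simp add: field_simps flip: power_add)
    also have "\<dots> = exp (10 * l)" using u exp_of_nat_mult[of 10 l] by (simp add: l_def exp_of_real)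
    finally have "complex_of_real (1 / u\<^sup>2 * u ^ 12) * exp (- ((x - 1) * l)) = exp ((12 - x - 1) * l)"
      by (simp add: algebra_simps flip: exp_add)
    moreover have "(1 / u\<^sup>2) *\<^sub>R G (- (- 1 / u)) = of_real (axis_L u) * (complex_of_real (1 / u\<^sup>2 * u ^ 12) * exp (- ((x - 1) * l)))"
      unfolding G_def using u axis_L_inversion[OF u] q[of "x - 1"] by (simp add: scaleR_conv_of_real)
    ultimately show ?thesis unfolding H_def p by simp
  qed
  have "(LINT t:{1<..}|lborel. G t) = (LBINT t=1..\<infinity>. G t)"
    by (simp add: interval_lebesgue_integral_def one_ereal_def)
  also have "\<dots> = (LBINT t=-\<infinity>..-1. G (- t))"
    using interval_integral_reflect[of 1 \<infinity> G] by simp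
  also have "\<dots> = (LBINT u=0..1. (1 / u\<^sup>2) *\<^sub>R G (- (- 1 / u)))"
  proof (rule interval_integral_substitution_integrable[where g = "\<lambda>u. - 1 / u"])
    fix u :: real assume "0 < ereal u" "ereal u < 1"
    hence u: "0 < u" "u < 1" by (auto simp: zero_ereal_def one_ereal_def)
    show "DERIV (\<lambda>u. - 1 / u) u :> 1 / u\<^sup>2"
      using u by (auto intro!: derivative_eq_intros simp: power2_eq_square)
    show "isCont (\<lambda>u. 1 / u\<^sup>2) u" using u by (auto intro!: continuous_intros)
    have "continuous_on {..<0} (\<lambda>t. G (- t))"
      unfolding G_def
      by (intro continuous_intros continuous_on_compose2[OF continuous_on_axis_L]) auto
    thus "isCont (\<lambda>t. G (- t)) (- 1 / u)"
      using u by (auto simp: continuous_on_eq_continuous_at)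
  next
    have eq: "(\<lambda>u::real. - 1 / u) = (\<lambda>u. - inverse u)" by (simp add: fun_eq_iff divide_inverse)
    have "((\<lambda>u. - inverse u) \<longlongrightarrow> - inverse 1) (at_left (1::real))" by (intro tendsto_intros) auto
    thus "((ereal \<circ> (\<lambda>u. - 1 / u) \<circ> real_of_ereal) \<longlongrightarrow> - 1) (at_left 1)"
      unfolding one_ereal_def uminus_ereal.simps ereal_tendsto_simps eq by simp
    have "filterlim (\<lambda>u::real. - inverse u) at_bot (at_right 0)"
      using filterlim_inverse_at_top_right unfolding filterlim_uminus_at_top .
    thus "((ereal \<circ> (\<lambda>u. - 1 / u) \<circ> real_of_ereal) \<longlongrightarrow> - \<infinity>) (at_right 0)"
      unfolding zero_ereal_def ereal_tendsto_simps eq .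
    have "set_integrable lborel {0<..<1} H" unfolding H_def[abs_def] by (rule half_mellin_integrable)
    also have "?this \<longleftrightarrow> set_integrable lborel {0<..<1} (\<lambda>u. (1 / u\<^sup>2) *\<^sub>R G (- (- 1 / u)))"
      by (intro set_integrable_cong) (use sub in auto)
    finally show "set_integrable lborel (einterval 0 1) (\<lambda>u. (1 / u\<^sup>2) *\<^sub>R G (- (- 1 / u)))"
      by (simp add: zero_ereal_def one_ereal_def)
    show "set_integrable lborel (einterval (- \<infinity>) (- 1)) (\<lambda>t. G (- t))"
      using ii' by (simp add: interval_lebesgue_integrable_def one_ereal_def)
  qed auto
  also have "\<dots> = (LINT u:{0<..<1}|lborel. (1 / u\<^sup>2) *\<^sub>R G (- (- 1 / u)))"
    by (simp add: interval_lebesgue_integral_def zero_ereal_def one_ereal_def)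
  also have "\<dots> = (LINT u:{0<..<1}|lborel. H u)"
    by (intro set_lebesgue_integral_cong) (use sub in auto)
  finally show ?thesis by (simp add: half_mellin_def G_def H_def)
qed

lemma completed_zeta_integral:
  fixes x :: complex
  assumes x: "Re x > 15 / 2"
  shows "half_mellin x + half_mellin (12 - x) = (2 * of_real pi) powr (- x) * Gamma x * ramanujan_zeta_series x"
proof -
  define G where "G t = of_real (axis_L t) * complex_of_real t powr (x - 1)" for t
  have int: "set_integrable lborel {0<..} G" unfolding G_def[abs_def] by (rule mellin_axis_L[OF x])
  have "(2 * of_real pi) powr (- x) * Gamma x * ramanujan_zeta_series x = (LINT t:{0<..}|lborel. G t)"
    unfolding G_def using mellin_axis_L(2)[OF x] by simp
  also have "\<dots> = (LINT t:{0<..<1} \<union> {1<..}|lborel. G t)"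
  proof (rule set_integral_cong_set)
    have "AE t in lborel. t \<noteq> (1::real)" by (rule AE_lborel_singleton)
    thus "AE t in lborel. (t \<in> {0<..<1::real} \<union> {1<..}) = (t \<in> {0<..})"
      by eventually_elim auto
    show "set_borel_measurable lborel {0<..} G"
      using int unfolding set_integrable_def set_borel_measurable_def by (rule borel_measurable_integrable)
    have "set_integrable lborel ({0<..<1} \<union> {1<..}) G" by (rule set_integrable_subset[OF int]) auto
    thus "set_borel_measurable lborel ({0<..<1} \<union> {1<..}) G"
      unfolding set_integrable_def set_borel_measurable_def by (rule borel_measurable_integrable)
  qed
  also have "\<dots> = (LINT t:{0<..<1}|lborel. G t) + (LINT t:{1<..}|lborel. G t)"
    by (intro set_integral_Un set_integrable_subset[OF int]) auto
  also have "\<dots> = half_mellin x + half_mellin (12 - x)"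
    unfolding G_def using mellin_upper_half int[unfolded G_def] by (simp add: half_mellin_def)
  finally show ?thesis ..
qed

text \<open>Holomorphy is read off the series, a power series in (x - 6)^2, with no differentiation
  under the integral. Every complex number is such a square, so the power series converges
  everywhere.\<close>

lemma completed_zeta_entire: "(\<lambda>x. half_mellin x + half_mellin (12 - x)) holomorphic_on UNIV"
proof -
  define g where "g z = (\<Sum>s. chi s * z ^ s)" for z
  have sums: "(\<lambda>s. chi s * z ^ s) sums g z" for z
  proof -
    have "(\<lambda>s. chi s * (6 + csqrt z - 6) ^ (2 * s)) sums (half_mellin (6 + csqrt z) + half_mellin (12 - (6 + csqrt z)))"
      by (rule chi_series_sums)
    hence "summable (\<lambda>s. chi s * z ^ s)" by (simp add: power_mult sums_iff)
    thus ?thesis by (simp add: g_def sums_iff)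
  qed
  have "g holomorphic_on ball 0 r" for r
    by (rule power_series_holomorphic[where a = chi]) (use sums in simp)
  hence "g holomorphic_on (\<Union>r. ball 0 r)" by (intro holomorphic_on_UN_open) auto
  also have "(\<Union>r. ball (0::complex) r) = UNIV"
  proof -
    have "z \<in> ball 0 (norm z + 1)" for z :: complex by simp
    thus ?thesis by blast
  qed
  finally have "(g \<circ> (\<lambda>x. (x - 6)\<^sup>2)) holomorphic_on UNIV"
    by (intro holomorphic_on_compose_gen[where t = UNIV] holomorphic_intros) auto
  moreover have "g ((x - 6)\<^sup>2) = half_mellin x + half_mellin (12 - x)" for x
    using sums[of "(x - 6)\<^sup>2"] chi_series_sums[of x] by (simp add: sums_iff flip: power_mult)
  ultimately show ?thesis by (simp add: o_def)
qed

section \<open>Uniqueness of the continuations\<close>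

lemma holomorphic_eq_on_right_half_plane:
  assumes f: "f holomorphic_on {x. Re x > a}" and g: "g holomorphic_on {x. Re x > a}"
    and ab: "a \<le> b" and eq: "\<And>x. Re x > b \<Longrightarrow> f x = g x" and x: "Re x > a"
  shows "f x = g x"
proof (rule analytic_continuation_open[of "{x. Re x > b}" "{x. Re x > a}" f g x])
  show "{x. Re x > b} \<noteq> {}" using ab by (auto intro!: exI[of _ "of_real (b + 1)"])
  show "connected {x. Re x > a}" by (intro convex_connected convex_halfspace_Re_gt)
qed (use assms in \<open>auto simp: open_halfspace_Re_gt\<close>)

text \<open>\<open>rGamma\<close> is entire, so the right-hand side has no poles. It agrees with the
  series for Re x > 15/2 by the Mellin integral, then for Re x > 13/2 because the series is
  holomorphic there.\<close>

lemma ramanujan_zeta_eq: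
  "ramanujan_zeta x = (2 * of_real pi) powr x * rGamma x * (half_mellin x + half_mellin (12 - x))"
proof -
  define H where "H x = (2 * of_real pi) powr x * rGamma x * (half_mellin x + half_mellin (12 - x))" for x
  have H: "H holomorphic_on UNIV"
    unfolding H_def[abs_def]
    by (rule holomorphic_on_mult[OF _ completed_zeta_entire]) (auto intro!: holomorphic_intros)
  have "H x = ramanujan_zeta_series x" if x: "Re x > 15 / 2" for x
  proof -
    have "x \<notin> \<int>\<^sub>\<le>\<^sub>0" using x by (auto elim!: nonpos_Ints_cases)
    hence "rGamma x * Gamma x = 1" by (simp add: rGamma_inverse_Gamma Gamma_eq_zero_iff)
    moreover have "(2 * of_real pi) powr x * (2 * of_real pi) powr (- x) = (1 :: complex)"
      by (simp add: powr_minus)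
    ultimately have "((2 * of_real pi) powr x * (2 * of_real pi) powr (- x)) * (rGamma x * Gamma x) * ramanujan_zeta_series x
      = ramanujan_zeta_series x" by simp
    thus ?thesis unfolding H_def completed_zeta_integral[OF x] by (simp only: mult_ac)
  qed
  hence series: "H x = ramanujan_zeta_series x" if "Re x > 13 / 2" for x
    using holomorphic_eq_on_right_half_plane[of H "13/2" ramanujan_zeta_series "15/2" x] that
      ramanujan_zeta_series_holomorphic H by (auto intro: holomorphic_on_subset)
  have "ramanujan_zeta = H"
    unfolding ramanujan_zeta_def
  proof (rule the_equality)
    show "H holomorphic_on UNIV \<and> (\<forall>x. Re x > 13 / 2 \<longrightarrow> H x = ramanujan_zeta_series x)"
      using H series by blast
    fix G assume G: "G holomorphic_on UNIV \<and> (\<forall>x. Re x > 13 / 2 \<longrightarrow> G x = ramanujan_zeta_series x)"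
    show "G = H"
    proof
      fix x
      \<comment> \<open>A half-plane Re > m containing both x and the region Re > 13/2 where
        \<open>G\<close> and \<open>H\<close> agree.\<close>
      define m where "m = min (Re x - 1) (13 / 2)"
      have m: "m \<le> 13 / 2" "m < Re x" unfolding m_def by linarith+
      show "G x = H x"
        by (rule holomorphic_eq_on_right_half_plane[of G m H "13/2" x])
           (use m G H series in \<open>auto intro: holomorphic_on_subset\<close>)
    qed
  qed
  hence "ramanujan_zeta x = H x" by (rule fun_cong)
  thus ?thesis unfolding H_def .
qed

text \<open>Away from the nonpositive integers \<open>Gamma\<close> cancels the
  \<open>rGamma\<close> of \<open>ramanujan_zeta_eq\<close>. For uniqueness it suffices to compare
  on Re x > 0, where Gamma has no poles; the identity theorem supplies the values at the excluded
  points.\<close>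

lemma xi_tau_eq: "xi_tau x = half_mellin x + half_mellin (12 - x)"
proof -
  define X where "X x = half_mellin x + half_mellin (12 - x)" for x
  have X: "X holomorphic_on UNIV" unfolding X_def[abs_def] by (rule completed_zeta_entire)
  have eq: "X x = (2 * of_real pi) powr (- x) * Gamma x * ramanujan_zeta x" if x: "x \<notin> \<int>\<^sub>\<le>\<^sub>0" for x
  proof -
    have "Gamma x * rGamma x = 1" using x by (simp add: rGamma_inverse_Gamma Gamma_eq_zero_iff)
    moreover have "(2 * of_real pi) powr (- x) * (2 * of_real pi) powr x = (1 :: complex)"
      by (simp add: powr_minus)
    ultimately have "((2 * of_real pi) powr (- x) * (2 * of_real pi) powr x) * (Gamma x * rGamma x) * X x = X x" by simp
    thus ?thesis unfolding ramanujan_zeta_eq X_def by (simp only: mult_ac)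
  qed
  have "xi_tau = X"
    unfolding xi_tau_def
  proof (rule the_equality)
    show "X holomorphic_on UNIV \<and> (\<forall>x. x \<notin> \<int>\<^sub>\<le>\<^sub>0 \<longrightarrow> X x = (2 * of_real pi) powr (- x) * Gamma x * ramanujan_zeta x)"
      using X eq by blast
    fix Y assume Y: "Y holomorphic_on UNIV \<and> (\<forall>x. x \<notin> \<int>\<^sub>\<le>\<^sub>0 \<longrightarrow> Y x = (2 * of_real pi) powr (- x) * Gamma x * ramanujan_zeta x)"
    show "Y = X"
    proof
      fix x
      have "z \<notin> \<int>\<^sub>\<le>\<^sub>0" if "Re z > 0" for z :: complex
        using that by (auto elim!: nonpos_Ints_cases)
      hence "Y z = X z" if "Re z > 0" for z using that Y eq by simp
      thus "Y x = X x"
        by (intro holomorphic_eq_on_right_half_plane[of Y "min (Re x - 1) 0" X 0 x])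
           (use X Y in \<open>auto intro: holomorphic_on_subset\<close>)
    qed
  qed
  hence "xi_tau x = X x" by (rule fun_cong)
  thus ?thesis unfolding X_def .
qed

theorem proposition1:
  shows "(\<forall>x::complex. (\<lambda>s. chi s * (x - 6) ^ (2 * s)) sums xi_tau x) \<and>
         (\<forall>s. chi s \<in> \<real> \<and> Re (chi s) > 0)"
  using chi_series_sums chi_real_pos unfolding xi_tau_eq by blast

end
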